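(* Let $a^\dag\in D(F)$, $h=F(a^\dag)$, $a^*\in H^2(\underline u,\overline u)$, and suppose that $$a^\dag-a^*=F'(a^\dag)^*w+e$$ holds for some $w\in L^2(0,T)$ and $e\in H^2(\underline u,\overline u)$. Let $L\|w\|_{L^2(0,T)}<1$, where $L$ is the Lipschitz constant of $F'$. Let $\delta\ge 0$, let $h^\delta\in L^2(0,T)$ satisfy $\|h^\delta-h\|_{L^2(0,T)}\le\delta$, let $\alpha>0$, and let $a_\alpha^\delta\in D(F)$ be a minimizer over $D(F)$ of $$J_\alpha^\delta(a)=\|F(a)-h^\delta\|_{L^2(0,T)}^2+\alpha\|a-a^*\|_{H^2(\underline u,\overline u)}^2.$$ Then $$\|a^\dag-a_\alpha^\delta\|_{H^2(\underline u,\overline u)}^2\le C\big(\delta^2/\alpha+\alpha\|w\|_{L^2(0,T)}^2+\delta\|w\|_{L^2(0,T)}+\|e\|_{H^2(\underline u,\overline u)}^2\big),$$ where the constant $C$ depends only on the size of $L\|w\|_{L^2(0,T)}$.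
   Context: Fix $T>0$ and positive constants $a_0,a_1,a_2,a_3$. Consider the condition (A1) $a\in W^{3,\infty}_{loc}(\mathbb R)$ with $a(0)=0$, $a_0\le a'(\cdot)\le a_1$, $|a''(\cdot)|\le a_2$, $|a'''(\cdot)|\le a_3$. Fix data satisfying (A2) $u_0=0$ and $p_0=c$ with $c\in\mathbb R$; (A3) $g_0,g_1\in C^4([0,T])$, $g_0(0)=g_1(0)=0$, $g_0'(0)=g_1'(0)=0$. State system: for $a$ satisfying (A1), $(p(a),u(a))\in C^1([0,T];L^2(0,1)^2)\cap C([0,T];H^1(0,1)^2)$ denotes the unique classical solution $(p,u)$ of $\partial_t p+\partial_x u=0$, $\partial_t u+\partial_x p+a(u)=0$ on $(0,1)\times(0,T)$ with $u(0,t)=g_0(t)$, $u(1,t)=g_1(t)$, $p(\cdot,0)=p_0$, $u(\cdot,0)=u_0$. There are constants $\underline u<\overline u$, independent of $a$, such that $\underline u\le u(x,t)\le\overline u$ for all $x\in[0,1]$, $t\in[0,T]$ and every $a$ satisfying (A1); fix such constants. Parameters are restricted to $[\underline u,\overline u]$ (the solution only depends on this restriction), and $D(F)=\{a\in H^2(\underline u,\overline u): \text{(A1) holds}\}$, i.e. the set of restrictions to $[\underline u,\overline u]$ of functions satisfying (A1) with the fixed constants; $D(F)$ is closed and convex. The forward operator is $F:D(F)\to L^2(0,T)$, $F(a)=\triangle p:=p(0,\cdot)-p(1,\cdot)$ with $(p,u)=(p(a),u(a))$. Derivative: for $a\in D(F)$ and $b\in H^2(\underline u,\overline u)$, $F'(a)b:=r(0,\cdot)-r(1,\cdot)$,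 where $(r,w)$ is the classical solution of the sensitivity system $\partial_t r+\partial_x w=0$, $\partial_t w+\partial_x r=-a'(u(a))w-b(u(a))$ on $(0,1)\times(0,T)$ with $r(x,0)=w(x,0)=0$ and $w(0,t)=w(1,t)=0$ (this $w$ is unrelated to the $w$ of the claim). $F$ is Fréchet differentiable relative to $D(F)$ with bounded linear derivative $F'(a):H^2(\underline u,\overline u)\to L^2(0,T)$, and $L$ denotes a constant with $\|F'(a)-F'(\tilde a)\|_{H^2(\underline u,\overline u)\to L^2(0,T)}\le L\|a-\tilde a\|_{H^2(\underline u,\overline u)}$ for all $a,\tilde a\in D(F)$. $F'(a^\dag)^*:L^2(0,T)\to H^2(\underline u,\overline u)$ is the Hilbert space adjoint. *)

theory Defs
  imports "HOL-Analysis.Analysis"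
begin

section \<open>Lebesgue and Sobolev spaces on open subsets of the real line\<close>

text \<open>Elements of all function spaces are represented by functions of type
  \<open>real \<Rightarrow> real\<close>. Values outside the underlying set are irrelevant; elements of
  \<open>L2 S\<close> only matter up to null sets.\<close>

definition L2 :: "real set \<Rightarrow> (real \<Rightarrow> real) set" where
  "L2 S = {f. f \<in> borel_measurable (lebesgue_on S) \<and> integrable (lebesgue_on S) (\<lambda>x. (f x)\<^sup>2)}"

definition l2_inner :: "real set \<Rightarrow> (real \<Rightarrow> real) \<Rightarrow> (real \<Rightarrow> real) \<Rightarrow> real" where
  "l2_inner S f g = (\<integral>x. f x * g x \<partial>lebesgue_on S)"

definition l2_norm :: "real set \<Rightarrow> (real \<Rightarrow> real) \<Rightarrow> real" where
  "l2_norm S f = sqrt (l2_inner S f f)"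

definition test_function :: "real set \<Rightarrow> (real \<Rightarrow> real) \<Rightarrow> bool" where
  "test_function S \<phi> \<longleftrightarrow>
     (\<forall>n x. (deriv ^^ n) \<phi> differentiable (at x)) \<and>
     (\<exists>K. compact K \<and> K \<subseteq> S \<and> (\<forall>x. x \<notin> K \<longrightarrow> \<phi> x = 0))"

definition locally_integrable :: "real set \<Rightarrow> (real \<Rightarrow> real) \<Rightarrow> bool" where
  "locally_integrable S f \<longleftrightarrow> (\<forall>K. compact K \<and> K \<subseteq> S \<longrightarrow> integrable (lebesgue_on K) f)"

definition has_weak_deriv :: "nat \<Rightarrow> real set \<Rightarrow> (real \<Rightarrow> real) \<Rightarrow> (real \<Rightarrow> real) \<Rightarrow> bool" where
  "has_weak_deriv k S f g \<longleftrightarrow>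
     locally_integrable S f \<and> locally_integrable S g \<and>
     (\<forall>\<phi>. test_function S \<phi> \<longrightarrow>
        (\<integral>x. f x * (deriv ^^ k) \<phi> x \<partial>lebesgue_on S) = (-1) ^ k * (\<integral>x. g x * \<phi> x \<partial>lebesgue_on S))"

text \<open>A weak derivative is unique only up to null sets; any representative will do.\<close>

definition weak_deriv :: "nat \<Rightarrow> real set \<Rightarrow> (real \<Rightarrow> real) \<Rightarrow> real \<Rightarrow> real" where
  "weak_deriv k S f = (SOME g. has_weak_deriv k S f g)"

definition sobolev_inner :: "nat \<Rightarrow> real set \<Rightarrow> (real \<Rightarrow> real) \<Rightarrow> (real \<Rightarrow> real) \<Rightarrow> real" where
  "sobolev_inner k S f g = (\<Sum>j\<le>k. l2_inner S (weak_deriv j S f) (weak_deriv j S g))"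

definition sobolev_norm :: "nat \<Rightarrow> real set \<Rightarrow> (real \<Rightarrow> real) \<Rightarrow> real" where
  "sobolev_norm k S f = sqrt (sobolev_inner k S f f)"

text \<open>\<open>sobolev k l r\<close> is the space \<open>H\<^sup>k(l,r)\<close>, used for \<open>k \<ge> 1\<close> only. By the Sobolev
  embedding every class has exactly one representative that is continuous on \<open>{l..r}\<close>, and
  this is the one taken here, so that boundary values and compositions make sense.\<close>

definition sobolev :: "nat \<Rightarrow> real \<Rightarrow> real \<Rightarrow> (real \<Rightarrow> real) set" where
  "sobolev k l r =
     {f. continuous_on {l..r} f \<and>
         (\<forall>j\<le>k. \<exists>g \<in> L2 {l<..<r}. has_weak_deriv j {l<..<r} f g)}"

definition Linf_loc :: "(real \<Rightarrow> real) \<Rightarrow> bool" where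
  "Linf_loc g \<longleftrightarrow> g \<in> borel_measurable lebesgue \<and>
     (\<forall>K. compact K \<longrightarrow> (\<exists>M. AE x in lebesgue_on K. \<bar>g x\<bar> \<le> M))"

definition W_inf_loc :: "nat \<Rightarrow> (real \<Rightarrow> real) \<Rightarrow> bool" where
  "W_inf_loc k f \<longleftrightarrow> (\<forall>j\<le>k. \<exists>g. has_weak_deriv j UNIV f g \<and> Linf_loc g)"

text \<open>\<open>C\<^sup>k([0,T])\<close>, with one-sided derivatives at the end points.\<close>

definition Ck_interval :: "nat \<Rightarrow> real \<Rightarrow> (real \<Rightarrow> real) \<Rightarrow> bool" where
  "Ck_interval k T g \<longleftrightarrow>
     (\<exists>G :: nat \<Rightarrow> real \<Rightarrow> real.
        (\<forall>t\<in>{0..T}. G 0 t = g t) \<and>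
        (\<forall>j<k. \<forall>t\<in>{0..T}. (G j has_real_derivative G (Suc j) t) (at t within {0..T})) \<and>
        continuous_on {0..T} (G k))"

section \<open>The state and sensitivity systems\<close>

definition condA1 :: "real \<Rightarrow> real \<Rightarrow> real \<Rightarrow> real \<Rightarrow> (real \<Rightarrow> real) \<Rightarrow> bool" where
  "condA1 a0 a1 a2 a3 a \<longleftrightarrow>
     continuous_on UNIV a \<and> W_inf_loc 3 a \<and> a 0 = 0 \<and>
     (AE x in lebesgue. a0 \<le> weak_deriv 1 UNIV a x \<and> weak_deriv 1 UNIV a x \<le> a1) \<and>
     (AE x in lebesgue. \<bar>weak_deriv 2 UNIV a x\<bar> \<le> a2) \<and>
     (AE x in lebesgue. \<bar>weak_deriv 3 UNIV a x\<bar> \<le> a3)"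

text \<open>Functions of space and time are written \<open>v x t\<close>. The next two definitions express
  \<open>v \<in> C([0,T]; H\<^sup>1(0,1))\<close>, and \<open>v \<in> C\<^sup>1([0,T]; L\<^sup>2(0,1))\<close> with time derivative \<open>vt\<close>.\<close>

definition C_H1 :: "real \<Rightarrow> (real \<Rightarrow> real \<Rightarrow> real) \<Rightarrow> bool" where
  "C_H1 T v \<longleftrightarrow>
     (\<forall>t\<in>{0..T}. (\<lambda>x. v x t) \<in> sobolev 1 0 1) \<and>
     (\<forall>s\<in>{0..T}. ((\<lambda>t. sobolev_norm 1 {0<..<1} (\<lambda>x. v x t - v x s)) \<longlongrightarrow> 0) (at s within {0..T}))"

definition C1_L2 :: "real \<Rightarrow> (real \<Rightarrow> real \<Rightarrow> real) \<Rightarrow> (real \<Rightarrow> real \<Rightarrow> real) \<Rightarrow> bool" where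
  "C1_L2 T v vt \<longleftrightarrow>
     (\<forall>t\<in>{0..T}. (\<lambda>x. v x t) \<in> L2 {0<..<1} \<and> (\<lambda>x. vt x t) \<in> L2 {0<..<1}) \<and>
     (\<forall>s\<in>{0..T}. ((\<lambda>t. l2_norm {0<..<1} (\<lambda>x. (v x t - v x s) / (t - s) - vt x s)) \<longlongrightarrow> 0)
        (at s within {0..T})) \<and>
     (\<forall>s\<in>{0..T}. ((\<lambda>t. l2_norm {0<..<1} (\<lambda>x. vt x t - vt x s)) \<longlongrightarrow> 0) (at s within {0..T}))"

text \<open>\<open>classical_solution T f p u\<close>: the pair \<open>(p,u)\<close> has the regularity of a classical
  solution and satisfies \<open>\<partial>\<^sub>t p + \<partial>\<^sub>x u = 0\<close>, \<open>\<partial>\<^sub>t u + \<partial>\<^sub>x p + f = 0\<close> on \<open>(0,1) \<times> (0,T)\<close>.\<close>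

definition classical_solution ::
  "real \<Rightarrow> (real \<Rightarrow> real \<Rightarrow> real) \<Rightarrow> (real \<Rightarrow> real \<Rightarrow> real) \<Rightarrow> (real \<Rightarrow> real \<Rightarrow> real) \<Rightarrow> bool" where
  "classical_solution T f p u \<longleftrightarrow>
     C_H1 T p \<and> C_H1 T u \<and>
     (\<exists>pt ut. C1_L2 T p pt \<and> C1_L2 T u ut \<and>
        (\<forall>t\<in>{0<..<T}. AE x in lebesgue_on {0<..<1}.
           pt x t + weak_deriv 1 {0<..<1} (\<lambda>y. u y t) x = 0 \<and>
           ut x t + weak_deriv 1 {0<..<1} (\<lambda>y. p y t) x + f x t = 0))"

definition state_solution ::
  "real \<Rightarrow> real \<Rightarrow> (real \<Rightarrow> real) \<Rightarrow> (real \<Rightarrow> real) \<Rightarrow> (real \<Rightarrow> real)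
     \<Rightarrow> (real \<Rightarrow> real \<Rightarrow> real) \<Rightarrow> (real \<Rightarrow> real \<Rightarrow> real) \<Rightarrow> bool" where
  "state_solution T c g0 g1 a p u \<longleftrightarrow>
     classical_solution T (\<lambda>x t. a (u x t)) p u \<and>
     (\<forall>t\<in>{0..T}. u 0 t = g0 t \<and> u 1 t = g1 t) \<and>
     (\<forall>x\<in>{0..1}. p x 0 = c \<and> u x 0 = 0)"

text \<open>In the sensitivity system \<open>u\<close> takes its values in \<open>{lo..hi}\<close>; accordingly the
  coefficient \<open>a'\<close> is the classical derivative relative to that interval.\<close>

definition sensitivity_solution ::
  "real \<Rightarrow> real \<Rightarrow> real \<Rightarrow> (real \<Rightarrow> real) \<Rightarrow> (real \<Rightarrow> real \<Rightarrow> real) \<Rightarrow> (real \<Rightarrow> real)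
     \<Rightarrow> (real \<Rightarrow> real \<Rightarrow> real) \<Rightarrow> (real \<Rightarrow> real \<Rightarrow> real) \<Rightarrow> bool" where
  "sensitivity_solution T lo hi a u b r w \<longleftrightarrow>
     classical_solution T
       (\<lambda>x t. vector_derivative a (at (u x t) within {lo..hi}) * w x t + b (u x t)) r w \<and>
     (\<forall>t\<in>{0..T}. w 0 t = 0 \<and> w 1 t = 0) \<and>
     (\<forall>x\<in>{0..1}. r x 0 = 0 \<and> w x 0 = 0)"

section \<open>The forward operator, its derivative and the adjoint\<close>

definition admissible ::
  "real \<Rightarrow> real \<Rightarrow> real \<Rightarrow> real \<Rightarrow> real \<Rightarrow> real \<Rightarrow> (real \<Rightarrow> real) set" where
  "admissible a0 a1 a2 a3 lo hi =
     {a \<in> sobolev 2 lo hi. \<exists>a'. condA1 a0 a1 a2 a3 a' \<and> (\<forall>y\<in>{lo..hi}. a y = a' y)}"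

text \<open>The solution pair \<open>(p(a), u(a))\<close> for \<open>a\<close> given on \<open>{lo..hi}\<close> only. It does not depend
  on the extension of \<open>a\<close>, and it is unique on \<open>{0..1} \<times> {0..T}\<close>; the choice operator merely
  fixes the irrelevant values elsewhere.\<close>

definition state ::
  "real \<Rightarrow> real \<Rightarrow> real \<Rightarrow> real \<Rightarrow> real \<Rightarrow> real \<Rightarrow> (real \<Rightarrow> real) \<Rightarrow> (real \<Rightarrow> real) \<Rightarrow> real \<Rightarrow> real
     \<Rightarrow> (real \<Rightarrow> real) \<Rightarrow> (real \<Rightarrow> real \<Rightarrow> real) \<times> (real \<Rightarrow> real \<Rightarrow> real)" where
  "state a0 a1 a2 a3 T c g0 g1 lo hi a =
     (SOME (p, u). \<exists>a'. condA1 a0 a1 a2 a3 a' \<and> (\<forall>y\<in>{lo..hi}. a y = a' y) \<and>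
        state_solution T c g0 g1 a' p u)"

definition pressure_drop :: "(real \<Rightarrow> real \<Rightarrow> real) \<Rightarrow> real \<Rightarrow> real" where
  "pressure_drop p = (\<lambda>t. p 0 t - p 1 t)"

definition forward ::
  "real \<Rightarrow> real \<Rightarrow> real \<Rightarrow> real \<Rightarrow> real \<Rightarrow> real \<Rightarrow> (real \<Rightarrow> real) \<Rightarrow> (real \<Rightarrow> real) \<Rightarrow> real \<Rightarrow> real
     \<Rightarrow> (real \<Rightarrow> real) \<Rightarrow> real \<Rightarrow> real" where
  "forward a0 a1 a2 a3 T c g0 g1 lo hi a = pressure_drop (fst (state a0 a1 a2 a3 T c g0 g1 lo hi a))"

definition forward_deriv ::
  "real \<Rightarrow> real \<Rightarrow> real \<Rightarrow> real \<Rightarrow> real \<Rightarrow> real \<Rightarrow> (real \<Rightarrow> real) \<Rightarrow> (real \<Rightarrow> real) \<Rightarrow> real \<Rightarrow> real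
     \<Rightarrow> (real \<Rightarrow> real) \<Rightarrow> (real \<Rightarrow> real) \<Rightarrow> real \<Rightarrow> real" where
  "forward_deriv a0 a1 a2 a3 T c g0 g1 lo hi a b =
     pressure_drop (fst (SOME (r, w).
       sensitivity_solution T lo hi a (snd (state a0 a1 a2 a3 T c g0 g1 lo hi a)) b r w))"

text \<open>Operators \<open>H\<^sup>2(lo,hi) \<rightarrow> L\<^sup>2(0,T)\<close>. Identities between values in \<open>L\<^sup>2(0,T)\<close> hold up to
  null sets.\<close>

definition bounded_linear_H2_L2 ::
  "real \<Rightarrow> real \<Rightarrow> real \<Rightarrow> ((real \<Rightarrow> real) \<Rightarrow> real \<Rightarrow> real) \<Rightarrow> bool" where
  "bounded_linear_H2_L2 lo hi T A \<longleftrightarrow>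
     (\<forall>b \<in> sobolev 2 lo hi. A b \<in> L2 {0<..<T}) \<and>
     (\<forall>b \<in> sobolev 2 lo hi. \<forall>b' \<in> sobolev 2 lo hi.
        AE t in lebesgue_on {0<..<T}. A (\<lambda>y. b y + b' y) t = A b t + A b' t) \<and>
     (\<forall>s. \<forall>b \<in> sobolev 2 lo hi.
        AE t in lebesgue_on {0<..<T}. A (\<lambda>y. s * b y) t = s * A b t) \<and>
     (\<exists>K. \<forall>b \<in> sobolev 2 lo hi. l2_norm {0<..<T} (A b) \<le> K * sobolev_norm 2 {lo<..<hi} b)"

definition opnorm_H2_L2 ::
  "real \<Rightarrow> real \<Rightarrow> real \<Rightarrow> ((real \<Rightarrow> real) \<Rightarrow> real \<Rightarrow> real) \<Rightarrow> real" where
  "opnorm_H2_L2 lo hi T A =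
     (SUP b \<in> sobolev 2 lo hi. l2_norm {0<..<T} (A b) / sobolev_norm 2 {lo<..<hi} b)"

text \<open>\<open>F : D \<rightarrow> L\<^sup>2(0,T)\<close> is Frechet differentiable relative to \<open>D \<subseteq> H\<^sup>2(lo,hi)\<close> with
  derivative \<open>F'\<close>.\<close>

definition frechet_rel ::
  "real \<Rightarrow> real \<Rightarrow> real \<Rightarrow> (real \<Rightarrow> real) set \<Rightarrow> ((real \<Rightarrow> real) \<Rightarrow> real \<Rightarrow> real)
     \<Rightarrow> ((real \<Rightarrow> real) \<Rightarrow> (real \<Rightarrow> real) \<Rightarrow> real \<Rightarrow> real) \<Rightarrow> bool" where
  "frechet_rel lo hi T D F F' \<longleftrightarrow>
     (\<forall>a\<in>D. F a \<in> L2 {0<..<T} \<and> bounded_linear_H2_L2 lo hi T (F' a) \<and>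
        (\<forall>\<epsilon>>0. \<exists>\<eta>>0. \<forall>a'\<in>D. sobolev_norm 2 {lo<..<hi} (\<lambda>y. a' y - a y) < \<eta> \<longrightarrow>
           l2_norm {0<..<T} (\<lambda>t. F a' t - F a t - F' a (\<lambda>y. a' y - a y) t)
             \<le> \<epsilon> * sobolev_norm 2 {lo<..<hi} (\<lambda>y. a' y - a y)))"

definition is_hilbert_adjoint ::
  "real \<Rightarrow> real \<Rightarrow> real \<Rightarrow> ((real \<Rightarrow> real) \<Rightarrow> real \<Rightarrow> real)
     \<Rightarrow> ((real \<Rightarrow> real) \<Rightarrow> real \<Rightarrow> real) \<Rightarrow> bool" where
  "is_hilbert_adjoint lo hi T A A' \<longleftrightarrow>
     (\<forall>w \<in> L2 {0<..<T}. A' w \<in> sobolev 2 lo hi \<and>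
        (\<forall>b \<in> sobolev 2 lo hi.
           l2_inner {0<..<T} (A b) w = sobolev_inner 2 {lo<..<hi} b (A' w)))"

definition tikhonov ::
  "real \<Rightarrow> real \<Rightarrow> real \<Rightarrow> ((real \<Rightarrow> real) \<Rightarrow> real \<Rightarrow> real) \<Rightarrow> real \<Rightarrow> (real \<Rightarrow> real)
     \<Rightarrow> (real \<Rightarrow> real) \<Rightarrow> (real \<Rightarrow> real) \<Rightarrow> real" where
  "tikhonov lo hi T F \<alpha> hm astar a =
     (l2_norm {0<..<T} (\<lambda>t. F a t - hm t))\<^sup>2
     + \<alpha> * (sobolev_norm 2 {lo<..<hi} (\<lambda>y. a y - astar y))\<^sup>2"

text \<open>Standing assumptions on the data. The last conjunct says that \<open>lo\<close> and \<open>hi\<close> are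
  bounds for all states \<open>u(a)\<close>, uniformly in \<open>a\<close>.\<close>

definition standing_assumptions ::
  "real \<Rightarrow> real \<Rightarrow> real \<Rightarrow> real \<Rightarrow> real \<Rightarrow> real \<Rightarrow> (real \<Rightarrow> real) \<Rightarrow> (real \<Rightarrow> real) \<Rightarrow> real \<Rightarrow> real
     \<Rightarrow> bool" where
  "standing_assumptions a0 a1 a2 a3 T c g0 g1 lo hi \<longleftrightarrow>
     T > 0 \<and> a0 > 0 \<and> a1 > 0 \<and> a2 > 0 \<and> a3 > 0 \<and>
     Ck_interval 4 T g0 \<and> Ck_interval 4 T g1 \<and> g0 0 = 0 \<and> g1 0 = 0 \<and>
     (g0 has_real_derivative 0) (at 0 within {0..T}) \<and>
     (g1 has_real_derivative 0) (at 0 within {0..T}) \<and>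
     lo < hi \<and>
     (\<forall>a p u. condA1 a0 a1 a2 a3 a \<and> state_solution T c g0 g1 a p u \<longrightarrow>
        (\<forall>x\<in>{0..1}. \<forall>t\<in>{0..T}. lo \<le> u x t \<and> u x t \<le> hi))"

end

theory Submission
  imports Defs
begin

text \<open>The estimate is a property of Tikhonov regularisation in Hilbert spaces: it follows from the
convexity of the parameter set and the Lipschitz continuity of the derivative of the forward
operator \<open>F\<close>. Write \<open>d\<close> for the reconstruction error
\<open>a\<alpha>\<delta> - adag\<close>, \<open>q\<close> for the residual norm \<open>\<parallel>F a\<alpha>\<delta> - h\<delta>\<parallel>\<close> and \<open>W = \<parallel>w\<parallel>\<close>.
Comparing the Tikhonov functional at the minimizer with its value at \<open>adag\<close>, and
expanding the square of the penalty, gives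
\<open>q\<^sup>2 + \<alpha> \<parallel>d\<parallel>\<^sup>2 \<le> \<delta>\<^sup>2 - 2 \<alpha> \<langle>adag - astar, d\<rangle>\<close>.
By the source condition the last inner product is \<open>\<langle>w, F'(adag) d\<rangle> + \<langle>e, d\<rangle>\<close>. Here
\<open>F'(adag) d\<close> is the difference \<open>F a\<alpha>\<delta> - F adag\<close>, of norm at most \<open>q + \<delta>\<close>, up to a
Taylor remainder whose inner product with \<open>w\<close> is controlled by \<open>L W \<parallel>d\<parallel>\<^sup>2 / 2\<close>
(lemma \<open>taylor_remainder\<close>). Since \<open>L W < 1\<close>, the resulting term \<open>\<alpha> L W \<parallel>d\<parallel>\<^sup>2\<close> is
absorbed on the left, and Young's inequality takes care of the terms that are linear in \<open>q\<close>
and \<open>\<parallel>d\<parallel>\<close> (lemma \<open>source_condition_absorption\<close>). This yields the constant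
\<open>4 / (1 - \<kappa>) + 4 / (1 - \<kappa>)\<^sup>2\<close> with \<open>\<kappa> = L W\<close>.

Two facts have to be supplied before this computation makes sense. Weak derivatives are chosen
representatives, so their linearity, and with it the bilinearity of the Sobolev inner product,
rests on the almost everywhere uniqueness of weak derivatives, that is, on the fundamental lemma
of the calculus of variations. And the Taylor remainder is estimated along the segment from
\<open>adag\<close> to \<open>a\<alpha>\<delta>\<close>, so the parameter set must be convex (lemma \<open>admissible_convex\<close>);
this is again a consequence of the linearity of weak derivatives.\<close>

section \<open>Smooth bump functions\<close>

text \<open>The recursion peels off the innermost derivative, so that the product and chain rules propagate
smoothness by induction on the order.\<close>

primrec times_differentiable :: "nat \<Rightarrow> (real \<Rightarrow> real) \<Rightarrow> bool" where
  "times_differentiable 0 f \<longleftrightarrow> True"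
| "times_differentiable (Suc n) f \<longleftrightarrow>
     (\<forall>x. f differentiable (at x)) \<and> times_differentiable n (deriv f)"

lemma times_differentiable_SucD:
  "times_differentiable (Suc n) f \<Longrightarrow> times_differentiable n f"
  by (induction n arbitrary: f) auto

lemma times_differentiable_SucI:
  assumes "\<And>x. (f has_real_derivative f' x) (at x)" "times_differentiable n f'"
  shows "times_differentiable (Suc n) f"
proof -
  have "deriv f = f'"
    using assms(1) by (intro ext DERIV_imp_deriv)
  with assms show ?thesis
    by (auto simp: real_differentiable_def)
qed

lemma times_differentiable_SucE:
  assumes "times_differentiable (Suc n) f"
  shows "(f has_real_derivative deriv f x) (at x)" "times_differentiable n (deriv f)"
  using assms by (auto simp: DERIV_deriv_iff_real_differentiable)

lemma times_differentiable_add: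
  "times_differentiable n f \<Longrightarrow> times_differentiable n g \<Longrightarrow> times_differentiable n (\<lambda>x. f x + g x)"
proof (induction n arbitrary: f g)
  case (Suc n)
  show ?case
    by (rule times_differentiable_SucI[where f' = "\<lambda>x. deriv f x + deriv g x"])
       (use Suc times_differentiable_SucE in \<open>auto intro!: derivative_eq_intros\<close>)
qed auto

lemma times_differentiable_mult:
  "times_differentiable n f \<Longrightarrow> times_differentiable n g \<Longrightarrow> times_differentiable n (\<lambda>x. f x * g x)"
proof (induction n arbitrary: f g)
  case (Suc n)
  note fg = times_differentiable_SucE[OF Suc.prems(1)] times_differentiable_SucE[OF Suc.prems(2)]
  have "times_differentiable n (\<lambda>x. deriv f x * g x + f x * deriv g x)"
    by (intro times_differentiable_add Suc.IH fg Suc.prems[THEN times_differentiable_SucD])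
  moreover have "((\<lambda>x. f x * g x) has_real_derivative deriv f x * g x + f x * deriv g x) (at x)" for x
    by (rule derivative_eq_intros fg refl)+ (simp add: algebra_simps)
  ultimately show ?case
    by (intro times_differentiable_SucI)
qed auto

lemma times_differentiable_const: "times_differentiable n (\<lambda>x. c)"
  by (induction n arbitrary: c) (auto intro!: times_differentiable_SucI derivative_eq_intros simp del: times_differentiable.simps(2))

lemma times_differentiable_affine:
  "times_differentiable n f \<Longrightarrow> times_differentiable n (\<lambda>x. f (p * x + q))"
proof (induction n arbitrary: f)
  case (Suc n)
  note f = times_differentiable_SucE[OF Suc.prems]
  have "times_differentiable n (\<lambda>x. p * deriv f (p * x + q))"
    by (intro times_differentiable_mult times_differentiable_const Suc.IH f)
  moreover have "((\<lambda>x. f (p * x + q)) has_real_derivative p * deriv f (p * x + q)) (at x)" for x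
    by (rule DERIV_chain2[where g = "\<lambda>x. p * x + q", OF f(1), THEN DERIV_cong])
       (auto intro!: derivative_eq_intros)
  ultimately show ?case
    by (intro times_differentiable_SucI)
qed auto

lemma times_differentiable_all:
  assumes "\<And>n. times_differentiable n f"
  shows "(deriv ^^ n) f differentiable (at x)"
  using assms
proof (induction n arbitrary: f)
  case 0
  then show ?case using times_differentiable.simps(2) by fastforce
next
  case (Suc n)
  have "times_differentiable m (deriv f)" for m
    using Suc.prems[of "Suc m"] by simp
  from Suc.IH[OF this] show ?case
    by (simp add: funpow_swap1)
qed

text \<open>For every \<open>k\<close> this is a function that is flat at the origin. The family is closed under
differentiation up to linear combinations, which gives smoothness of all its members at once;
the case \<open>k = 0\<close> is the usual building block \<open>exp (- 1 / x)\<close> of bump functions.\<close>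

definition flat_exp :: "nat \<Rightarrow> real \<Rightarrow> real" where
  "flat_exp k x = (if x > 0 then inverse x ^ k * exp (- inverse x) else 0)"

text \<open>After the substitution \<open>y = 1 / x\<close> this is the fact that the exponential outgrows every power.\<close>

lemma flat_exp_tendsto_0: "(flat_exp k \<longlongrightarrow> 0) (at 0)"
proof -
  have "((\<lambda>y. y ^ k / exp y) \<longlongrightarrow> (0::real)) at_top"
    by (rule tendsto_power_div_exp_0)
  from filterlim_compose[OF this filterlim_inverse_at_top_right]
  have "((\<lambda>x. inverse x ^ k / exp (inverse x)) \<longlongrightarrow> (0::real)) (at_right 0)" .
  then have r: "(flat_exp k \<longlongrightarrow> 0) (at_right 0)"
    by (rule Lim_transform_eventually)
       (auto simp: eventually_at_filter flat_exp_def exp_minus divide_inverse)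
  have l: "(flat_exp k \<longlongrightarrow> 0) (at_left 0)"
    by (rule tendsto_eventually) (auto simp: eventually_at_filter flat_exp_def)
  show ?thesis
    using l r by (simp add: filterlim_at_split)
qed

lemma flat_exp_has_derivative:
  "(flat_exp k has_real_derivative flat_exp (k + 2) x + (- real k) * flat_exp (k + 1) x) (at x)"
proof (cases x "0::real" rule: linorder_cases)
  case less
  have "((\<lambda>_. 0) has_real_derivative 0) (at x)" by simp
  then have "(flat_exp k has_real_derivative 0) (at x)"
    by (rule has_field_derivative_transform_within_open[where S = "{..<0}"])
       (use less in \<open>auto simp: flat_exp_def\<close>)
  with less show ?thesis by (simp add: flat_exp_def)
next
  case equal
  \<comment> \<open>at the origin the difference quotient is again a member of the family, with exponent raised by one\<close>
  have "((\<lambda>h. flat_exp k h / h) \<longlongrightarrow> 0) (at 0)"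
    by (rule Lim_transform_eventually[OF flat_exp_tendsto_0[of "Suc k"]])
       (auto simp: eventually_at_filter flat_exp_def divide_inverse)
  with equal show ?thesis
    by (simp add: DERIV_def flat_exp_def)
next
  case greater
  have "((\<lambda>x. inverse x ^ k * exp (- inverse x)) has_real_derivative
          flat_exp (k + 2) x + (- real k) * flat_exp (k + 1) x) (at x)"
    using greater
    by (auto intro!: derivative_eq_intros simp: flat_exp_def)
       (cases k; auto simp: field_simps power2_eq_square)
  then show ?thesis
    by (rule has_field_derivative_transform_within_open[where S = "{0<..}"])
       (use greater in \<open>auto simp: flat_exp_def\<close>)
qed

lemma times_differentiable_flat_exp: "times_differentiable n (flat_exp k)"
proof (induction n arbitrary: k)
  case (Suc n)
  show ?case
    by (rule times_differentiable_SucI[OF flat_exp_has_derivative])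
       (intro times_differentiable_add times_differentiable_mult times_differentiable_const Suc.IH)
qed auto

text \<open>As \<open>n\<close> grows, these functions tend to the indicator of the open interval from \<open>a\<close> to
\<open>b\<close>, because \<open>exp (- 1 / (n y))\<close> tends to \<open>1\<close> for each \<open>y > 0\<close>.\<close>

definition bump :: "real \<Rightarrow> real \<Rightarrow> nat \<Rightarrow> real \<Rightarrow> real" where
  "bump a b n x = flat_exp 0 (real n * (x - a)) * flat_exp 0 (real n * (b - x))"

lemma test_function_bump:
  assumes "{a..b} \<subseteq> S"
  shows "test_function S (bump a b n)"
proof -
  have "times_differentiable m (\<lambda>x. flat_exp 0 (real n * x + (- real n * a)) * flat_exp 0 ((- real n) * x + real n * b))" for m
    by (intro times_differentiable_mult times_differentiable_affine times_differentiable_flat_exp)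
  also have "(\<lambda>x. flat_exp 0 (real n * x + (- real n * a)) * flat_exp 0 ((- real n) * x + real n * b)) = bump a b n"
    by (auto simp: bump_def algebra_simps)
  finally have "(deriv ^^ m) (bump a b n) differentiable (at x)" for m x
    by (rule times_differentiable_all)
  moreover have "bump a b n x = 0" if "x \<notin> {a..b}" for x
    using that by (auto simp: bump_def flat_exp_def zero_less_mult_iff)
  ultimately show ?thesis
    unfolding test_function_def using assms by (metis compact_Icc)
qed

lemma bump_bounds: "\<bar>bump a b n x\<bar> \<le> 1"
proof -
  have "0 \<le> flat_exp 0 y \<and> flat_exp 0 y \<le> 1" for y
    by (auto simp: flat_exp_def)
  then show ?thesis
    unfolding bump_def abs_mult by (simp add: mult_le_one)
qed

lemma bump_tendsto_1:
  assumes "a < x" "x < b"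
  shows "(\<lambda>n. bump a b n x) \<longlonglongrightarrow> 1"
proof -
  have *: "(\<lambda>n. flat_exp 0 (real n * y)) \<longlonglongrightarrow> 1" if "y > 0" for y
  proof -
    have "(\<lambda>n. exp (- inverse (real n) * inverse y)) \<longlonglongrightarrow> exp (- 0 * inverse y)"
      by (intro tendsto_intros lim_inverse_n)
    then have "(\<lambda>n. exp (- inverse (real n) * inverse y)) \<longlonglongrightarrow> 1" by simp
    then show ?thesis
    proof (rule Lim_transform_eventually)
      show "\<forall>\<^sub>F n in sequentially. exp (- inverse (real n) * inverse y) = flat_exp 0 (real n * y)"
        using eventually_gt_at_top[of 0] by eventually_elim (use that in \<open>simp add: flat_exp_def\<close>)
    qed
  qed
  show ?thesis
    unfolding bump_def using tendsto_mult[OF *[of "x - a"] *[of "b - x"]] assms by simp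
qed

section \<open>The fundamental lemma of the calculus of variations\<close>

lemma integral_zero_extension:
  fixes f :: "real \<Rightarrow> real"
  assumes "K \<subseteq> S" "K \<in> sets lebesgue" "S \<in> sets lebesgue" "\<And>x. x \<in> S - K \<Longrightarrow> f x = 0"
  shows "integrable (lebesgue_on S) f \<longleftrightarrow> integrable (lebesgue_on K) f"
    and "integral\<^sup>L (lebesgue_on S) f = integral\<^sup>L (lebesgue_on K) f"
proof -
  have "(\<lambda>x. indicator S x *\<^sub>R f x) = (\<lambda>x. indicator K x *\<^sub>R f x)"
    using assms(1,4) by (auto simp: indicator_def fun_eq_iff)
  then show "integrable (lebesgue_on S) f \<longleftrightarrow> integrable (lebesgue_on K) f"
    and "integral\<^sup>L (lebesgue_on S) f = integral\<^sup>L (lebesgue_on K) f"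
    using assms(2,3) by (simp_all add: integrable_restrict_space integral_restrict_space)
qed

text \<open>Completeness of Lebesgue measure is what makes an arbitrarily chosen representative of a weak
derivative measurable.\<close>

lemma measurable_lebesgue_on_AE:
  fixes f g :: "real \<Rightarrow> real"
  assumes f: "f \<in> borel_measurable (lebesgue_on S)" and S: "S \<in> sets lebesgue"
    and ae: "AE x in lebesgue_on S. f x = g x"
  shows "g \<in> borel_measurable (lebesgue_on S)"
proof -
  have "(\<lambda>x. if x \<in> S then f x else 0) \<in> borel_measurable lebesgue"
    using f S by (simp add: borel_measurable_if)
  moreover have "AE x in lebesgue. (if x \<in> S then f x else 0) = (if x \<in> S then g x else 0)"
    using ae S by (auto simp: AE_restrict_space_iff elim!: eventually_mono)
  ultimately have "(\<lambda>x. if x \<in> S then g x else 0) \<in> borel_measurable lebesgue"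
    by (rule borel_measurable_AE)
  then show ?thesis
    using S by (simp add: borel_measurable_if)
qed

lemma test_function_continuous:
  assumes "test_function S \<phi>"
  shows "continuous_on A \<phi>"
proof -
  have "(deriv ^^ 0) \<phi> differentiable (at x)" for x
    using assms unfolding test_function_def by blast
  then show ?thesis
    by (simp add: differentiable_imp_continuous_within continuous_at_imp_continuous_on)
qed

lemma test_function_deriv:
  assumes "test_function S \<phi>"
  shows "test_function S ((deriv ^^ k) \<phi>)"
proof (induction k)
  case (Suc k)
  let ?\<psi> = "(deriv ^^ k) \<phi>"
  obtain K where K: "compact K" "K \<subseteq> S" "\<And>x. x \<notin> K \<Longrightarrow> ?\<psi> x = 0"
    using Suc unfolding test_function_def by blast
  have "deriv ?\<psi> x = 0" if "x \<notin> K" for x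
  proof -
    have "((\<lambda>_. 0) has_real_derivative 0) (at x)" by simp
    then have "(?\<psi> has_real_derivative 0) (at x)"
      by (rule has_field_derivative_transform_within_open[where S = "- K"])
         (use that K in \<open>auto simp: compact_imp_closed\<close>)
    then show ?thesis by (rule DERIV_imp_deriv)
  qed
  moreover have "(deriv ^^ n) (deriv ?\<psi>) differentiable (at x)" for n x
  proof -
    have "(deriv ^^ Suc n) ?\<psi> differentiable (at x)"
      using Suc unfolding test_function_def by blast
    then show ?thesis by (simp add: funpow_swap1)
  qed
  ultimately show ?case
    using K(1,2) unfolding test_function_def by auto
qed (use assms in simp)

lemma integrable_test_function:
  assumes f: "locally_integrable S f" and \<phi>: "test_function S \<phi>" and S: "S \<in> sets lebesgue"
  shows "integrable (lebesgue_on S) (\<lambda>x. f x * \<phi> x)"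
proof -
  obtain K where K: "compact K" "K \<subseteq> S" "\<And>x. x \<notin> K \<Longrightarrow> \<phi> x = 0"
    using \<phi> unfolding test_function_def by blast
  have Km: "K \<in> sets lebesgue"
    using K(1) by (simp add: compact_imp_closed borel_closed)
  have "bounded (\<phi> ` K)"
    using K(1) test_function_continuous[OF \<phi>] compact_continuous_image compact_imp_bounded by blast
  then obtain B where B: "\<And>x. x \<in> K \<Longrightarrow> \<bar>\<phi> x\<bar> \<le> B"
    unfolding bounded_iff by auto
  have fK: "integrable (lebesgue_on K) f"
    using f K unfolding locally_integrable_def by blast
  have "integrable (lebesgue_on K) (\<lambda>x. f x * \<phi> x)"
  proof (rule Bochner_Integration.integrable_bound)
    show "integrable (lebesgue_on K) (\<lambda>x. B * f x)" using fK by simp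
    show "(\<lambda>x. f x * \<phi> x) \<in> borel_measurable (lebesgue_on K)"
      by (intro borel_measurable_times borel_measurable_integrable[OF fK]
            continuous_imp_measurable_on_sets_lebesgue Km test_function_continuous[OF \<phi>])
    show "AE x in lebesgue_on K. norm (f x * \<phi> x) \<le> norm (B * f x)"
    proof (rule AE_I2)
      fix x assume "x \<in> space (lebesgue_on K)"
      then have "\<bar>\<phi> x\<bar> \<le> \<bar>B\<bar>" using B[of x] by auto
      then show "norm (f x * \<phi> x) \<le> norm (B * f x)"
        by (simp add: abs_mult mult.commute mult_right_mono)
    qed
  qed
  then show ?thesis
    using integral_zero_extension(1)[of K S "\<lambda>x. f x * \<phi> x"] K Km S by auto
qed

text \<open>Bump functions converge boundedly to the indicator of the interval, so dominated convergence
applies.\<close>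

lemma fundamental_lemma_interval:
  assumes f: "locally_integrable S f" and S: "S \<in> sets lebesgue"
    and zero: "\<And>\<phi>. test_function S \<phi> \<Longrightarrow> (\<integral>x. f x * \<phi> x \<partial>lebesgue_on S) = 0"
    and ab: "{a..b} \<subseteq> S"
  shows "integral\<^sup>L (lebesgue_on {a..b}) f = 0"
proof -
  have fi: "integrable (lebesgue_on {a..b}) f"
    using f ab unfolding locally_integrable_def by (metis compact_Icc)
  have ends: "AE x in lebesgue_on {a..b}. x \<noteq> a \<and> x \<noteq> b"
  proof -
    have "negligible {a, b}" by simp
    then have "AE x in lebesgue. x \<notin> {a, b}"
      unfolding negligible_iff_null_sets by (rule AE_not_in)
    then show ?thesis
      by (subst AE_restrict_space_iff) (auto simp del: AE_conj_iff elim!: eventually_mono)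
  qed
  have "(\<lambda>n. \<integral>x. f x * bump a b n x \<partial>lebesgue_on {a..b}) \<longlonglongrightarrow> integral\<^sup>L (lebesgue_on {a..b}) f"
  proof (rule integral_dominated_convergence)
    show "integrable (lebesgue_on {a..b}) (\<lambda>x. \<bar>f x\<bar>)" using fi by simp
    show "f \<in> borel_measurable (lebesgue_on {a..b})" using fi by simp
    show "(\<lambda>x. f x * bump a b n x) \<in> borel_measurable (lebesgue_on {a..b})" for n
      by (intro borel_measurable_times borel_measurable_integrable[OF fi]
            continuous_imp_measurable_on_sets_lebesgue
            test_function_continuous[OF test_function_bump[OF ab]]) simp
    show "AE x in lebesgue_on {a..b}. (\<lambda>n. f x * bump a b n x) \<longlonglongrightarrow> f x"
      using ends AE_space
    proof eventually_elim
      case (elim x)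
      have "(\<lambda>n. f x * bump a b n x) \<longlonglongrightarrow> f x * 1"
        by (intro tendsto_intros bump_tendsto_1) (use elim in auto)
      then show ?case by simp
    qed
    show "AE x in lebesgue_on {a..b}. norm (f x * bump a b n x) \<le> \<bar>f x\<bar>" for n
      using mult_left_mono[OF bump_bounds abs_ge_zero] by (auto simp: abs_mult)
  qed
  moreover have "(\<integral>x. f x * bump a b n x \<partial>lebesgue_on {a..b}) = 0" for n
  proof -
    have "(\<integral>x. f x * bump a b n x \<partial>lebesgue_on {a..b}) = (\<integral>x. f x * bump a b n x \<partial>lebesgue_on S)"
      by (rule integral_zero_extension(2)[symmetric])
         (use ab S in \<open>auto simp: bump_def flat_exp_def zero_less_mult_iff\<close>)
    also have "\<dots> = 0"
      by (rule zero[OF test_function_bump[OF ab]])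
    finally show ?thesis .
  qed
  ultimately show ?thesis
    by (simp add: LIMSEQ_const_iff)
qed

text \<open>By the Lebesgue differentiation theorem the integrand is almost everywhere the limit of its
averages over shrinking intervals, and these averages all vanish. The function is cut off
outside the interval so that the theorem, which speaks of the whole line, applies.\<close>

lemma AE_zero_if_interval_integrals_zero:
  fixes f :: "real \<Rightarrow> real"
  assumes f: "integrable (lebesgue_on {c..d}) f"
    and zero: "\<And>a b. {a..b} \<subseteq> {c..d} \<Longrightarrow> integral\<^sup>L (lebesgue_on {a..b}) f = 0"
  shows "AE x in lebesgue. x \<in> {c..d} \<longrightarrow> f x = 0"
proof -
  define g :: "real \<Rightarrow> real" where "g = (\<lambda>x. if x \<in> {c..d} then f x else 0)"
  have g0: "g integrable_on cbox a b" "integral (cbox a b) g = 0" for a b :: real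
  proof -
    have I: "{c..d} \<inter> cbox a b = {max c a .. min d b}" by auto
    have fi: "integrable (lebesgue_on {max c a .. min d b}) f"
    proof -
      have "set_integrable lebesgue {c..d} f"
        using f by (simp add: set_integrable_def integrable_restrict_space)
      then have "set_integrable lebesgue {max c a .. min d b} f"
        by (rule set_integrable_subset) auto
      then show ?thesis
        by (simp add: set_integrable_def integrable_restrict_space)
    qed
    show "g integrable_on cbox a b"
      unfolding g_def integrable_restrict_Int I using integrable_on_lebesgue_on[OF fi] by simp
    show "integral (cbox a b) g = 0"
      unfolding g_def Henstock_Kurzweil_Integration.integral_restrict_Int I
      using lebesgue_integral_eq_integral[OF fi] zero[of "max c a" "min d b"] by auto
  qed
  obtain N where N: "negligible N"
     and lim: "\<And>x e. \<lbrakk>x \<notin> N; 0 < e\<rbrakk> \<Longrightarrow> \<exists>d>0. \<forall>h. 0 < h \<and> h < d \<longrightarrow>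
                norm (integral (cbox x (x + h *\<^sub>R One)) g /\<^sub>R h ^ DIM(real) - g x) < e"
    using integrable_ccontinuous_explicit[of g] g0(1) by metis
  have "g x = 0" if x: "x \<notin> N" for x
  proof (rule ccontr)
    assume "g x \<noteq> 0"
    then obtain d where "d > 0" and
      d: "\<forall>h. 0 < h \<and> h < d \<longrightarrow> norm (integral (cbox x (x + h *\<^sub>R One)) g /\<^sub>R h ^ DIM(real) - g x) < \<bar>g x\<bar>"
      using lim[OF x, of "\<bar>g x\<bar>"] by auto
    from d[rule_format, of "d/2"] \<open>d > 0\<close> show False
      unfolding g0(2) by simp
  qed
  moreover have "AE x in lebesgue. x \<notin> N"
    using N by (intro AE_not_in) (simp add: negligible_iff_null_sets)
  ultimately have "AE x in lebesgue. g x = 0"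
    by (auto elim!: eventually_mono)
  then show ?thesis
    unfolding g_def by (rule eventually_mono) (auto split: if_splits)
qed

text \<open>Countably many compact intervals, those with rational end points, cover the open set, so the
exceptional null sets of the intervals can be united.\<close>

theorem fundamental_lemma_calculus_of_variations:
  assumes f: "locally_integrable S f" and S: "open S"
    and zero: "\<And>\<phi>. test_function S \<phi> \<Longrightarrow> (\<integral>x. f x * \<phi> x \<partial>lebesgue_on S) = 0"
  shows "AE x in lebesgue_on S. f x = 0"
proof -
  have Sm: "S \<in> sets lebesgue" using S by simp
  define R where "R = {(c, d). c \<in> \<rat> \<and> d \<in> \<rat> \<and> {c..d} \<subseteq> S}"
  have "countable R"
    by (rule countable_subset[of _ "\<rat> \<times> \<rat>"]) (auto simp: R_def countable_rat)
  moreover have "AE x in lebesgue. x \<in> {fst r..snd r} \<longrightarrow> f x = 0" if "r \<in> R" for r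
  proof (rule AE_zero_if_interval_integrals_zero)
    have sub: "{fst r..snd r} \<subseteq> S" using that by (auto simp: R_def)
    then show "integrable (lebesgue_on {fst r..snd r}) f"
      using f unfolding locally_integrable_def by (metis compact_Icc)
    show "integral\<^sup>L (lebesgue_on {a..b}) f = 0" if "{a..b} \<subseteq> {fst r..snd r}" for a b
      using fundamental_lemma_interval[OF f Sm zero] that sub by blast
  qed
  ultimately have "AE x in lebesgue. \<forall>r\<in>R. x \<in> {fst r..snd r} \<longrightarrow> f x = 0"
    by (subst AE_ball_countable) auto
  then have "AE x in lebesgue. x \<in> S \<longrightarrow> f x = 0"
  proof eventually_elim
    case (elim x)
    show ?case
    proof
      assume "x \<in> S"
      then obtain e where e: "e > 0" "cball x e \<subseteq> S"
        using S open_contains_cball by blast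
      obtain c where c: "c \<in> \<rat>" "x - e < c" "c < x"
        using Rats_dense_in_real[of "x - e" x] e by auto
      obtain d where d: "d \<in> \<rat>" "x < d" "d < x + e"
        using Rats_dense_in_real[of x "x + e"] e by auto
      have "{c..d} \<subseteq> S"
        using c d e(2) by (auto simp: cball_def dist_real_def subset_iff)
      with c d have "(c, d) \<in> R" by (auto simp: R_def)
      with elim c d show "f x = 0" by force
    qed
  qed
  then show ?thesis
    using Sm by (simp add: AE_restrict_space_iff)
qed

section \<open>Uniqueness and linearity of weak derivatives\<close>

lemma locally_integrable_lincomb:
  assumes "locally_integrable S f" "locally_integrable S g"
  shows "locally_integrable S (\<lambda>x. p * f x + q * g x)"
  using assms unfolding locally_integrable_def by auto

lemma has_weak_deriv_lincomb:
  assumes S: "S \<in> sets lebesgue" and f: "has_weak_deriv k S f f'" and g: "has_weak_deriv k S g g'"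
  shows "has_weak_deriv k S (\<lambda>x. p * f x + q * g x) (\<lambda>x. p * f' x + q * g' x)"
proof -
  have li: "locally_integrable S f" "locally_integrable S g" "locally_integrable S f'" "locally_integrable S g'"
    using f g unfolding has_weak_deriv_def by blast+
  have lin: "(\<integral>x. (p * u x + q * v x) * \<psi> x \<partial>lebesgue_on S)
      = p * (\<integral>x. u x * \<psi> x \<partial>lebesgue_on S) + q * (\<integral>x. v x * \<psi> x \<partial>lebesgue_on S)"
    if "locally_integrable S u" "locally_integrable S v" "test_function S \<psi>" for u v \<psi>
  proof -
    have "(\<integral>x. (p * u x + q * v x) * \<psi> x \<partial>lebesgue_on S)
        = (\<integral>x. p * (u x * \<psi> x) + q * (v x * \<psi> x) \<partial>lebesgue_on S)"
      by (rule arg_cong[where f = "integral\<^sup>L _"]) (auto simp: algebra_simps)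
    also have "\<dots> = p * (\<integral>x. u x * \<psi> x \<partial>lebesgue_on S) + q * (\<integral>x. v x * \<psi> x \<partial>lebesgue_on S)"
      using that integrable_test_function[OF _ _ S] by (subst Bochner_Integration.integral_add) auto
    finally show ?thesis .
  qed
  have "(\<integral>x. (p * f x + q * g x) * (deriv ^^ k) \<phi> x \<partial>lebesgue_on S)
       = (-1) ^ k * (\<integral>x. (p * f' x + q * g' x) * \<phi> x \<partial>lebesgue_on S)" if "test_function S \<phi>" for \<phi>
    using f g that lin[OF li(1,2) test_function_deriv[OF that]] lin[OF li(3,4) that]
    by (auto simp: has_weak_deriv_def algebra_simps)
  then show ?thesis
    unfolding has_weak_deriv_def using locally_integrable_lincomb li by blast
qed

lemma has_weak_deriv_unique:
  assumes S: "open S" and g: "has_weak_deriv k S f g" and h: "has_weak_deriv k S f h"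
  shows "AE x in lebesgue_on S. g x = h x"
proof -
  have "AE x in lebesgue_on S. 1 * g x + (-1) * h x = 0"
  proof (rule fundamental_lemma_calculus_of_variations[OF _ S])
    show "locally_integrable S (\<lambda>x. 1 * g x + (-1) * h x)"
      using g h by (intro locally_integrable_lincomb) (auto simp: has_weak_deriv_def)
    fix \<phi> assume \<phi>: "test_function S \<phi>"
    have "has_weak_deriv k S (\<lambda>x. 1 * f x + (-1) * f x) (\<lambda>x. 1 * g x + (-1) * h x)"
      using S by (intro has_weak_deriv_lincomb g h) simp
    then have "(\<integral>x. 0 \<partial>lebesgue_on S) = (-1) ^ k * (\<integral>x. (1 * g x + (-1) * h x) * \<phi> x \<partial>lebesgue_on S)"
      using \<phi> by (simp add: has_weak_deriv_def)
    then show "(\<integral>x. (1 * g x + (-1) * h x) * \<phi> x \<partial>lebesgue_on S) = 0" by simp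
  qed
  then show ?thesis by (auto elim: eventually_mono)
qed

lemma weak_deriv_AE:
  assumes "open S" "has_weak_deriv k S f g"
  shows "AE x in lebesgue_on S. weak_deriv k S f x = g x"
  using assms has_weak_deriv_unique[OF assms(1)] unfolding weak_deriv_def by (metis someI_ex)

lemma has_weak_deriv_cong:
  assumes "\<And>x. x \<in> S \<Longrightarrow> f x = g x"
  shows "has_weak_deriv k S f = has_weak_deriv k S g"
proof -
  have "integrable (lebesgue_on K) f \<longleftrightarrow> integrable (lebesgue_on K) g" if "K \<subseteq> S" for K
    by (rule Bochner_Integration.integrable_cong) (use assms that in auto)
  then have "locally_integrable S f \<longleftrightarrow> locally_integrable S g"
    unfolding locally_integrable_def by auto
  moreover have "(\<integral>x. f x * \<psi> x \<partial>lebesgue_on S) = (\<integral>x. g x * \<psi> x \<partial>lebesgue_on S)" for \<psi>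
    by (rule Bochner_Integration.integral_cong) (use assms in auto)
  ultimately show ?thesis
    by (simp add: has_weak_deriv_def fun_eq_iff)
qed

text \<open>The two sides are literally equal, not only almost everywhere: both choices are made from the
same set of weak derivatives.\<close>

lemma weak_deriv_cong:
  assumes "\<And>x. x \<in> S \<Longrightarrow> f x = g x"
  shows "weak_deriv k S f = weak_deriv k S g"
  unfolding weak_deriv_def using has_weak_deriv_cong[OF assms] by simp

lemma weak_deriv_lincomb_AE:
  assumes S: "open S" and "has_weak_deriv k S f f'" "has_weak_deriv k S g g'"
  shows "AE x in lebesgue_on S.
    weak_deriv k S (\<lambda>x. p * f x + q * g x) x = p * weak_deriv k S f x + q * weak_deriv k S g x"
proof -
  have "has_weak_deriv k S (\<lambda>x. p * f x + q * g x) (\<lambda>x. p * f' x + q * g' x)"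
    using assms by (intro has_weak_deriv_lincomb) auto
  from weak_deriv_AE[OF S this] weak_deriv_AE[OF S assms(2)] weak_deriv_AE[OF S assms(3)]
  show ?thesis by eventually_elim simp
qed

section \<open>Semi-inner products on spaces of functions\<close>

text \<open>Square-integrable functions and Sobolev functions are represented by plain functions, so their
inner products are only semidefinite and the spaces are subsets of a function type. The locale
collects the Hilbert space geometry that survives in this setting; it is used once for the
parameters and once for the data.\<close>

locale semi_inner_product_space =
  fixes V :: "('a \<Rightarrow> real) set" and ip :: "('a \<Rightarrow> real) \<Rightarrow> ('a \<Rightarrow> real) \<Rightarrow> real"
  assumes lincomb: "f \<in> V \<Longrightarrow> g \<in> V \<Longrightarrow> (\<lambda>x. p * f x + q * g x) \<in> V"
    and ip_lincomb: "f \<in> V \<Longrightarrow> g \<in> V \<Longrightarrow> h \<in> V \<Longrightarrow>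
          ip (\<lambda>x. p * f x + q * g x) h = p * ip f h + q * ip g h"
    and ip_commute: "f \<in> V \<Longrightarrow> g \<in> V \<Longrightarrow> ip f g = ip g f"
    and ip_nonneg: "f \<in> V \<Longrightarrow> 0 \<le> ip f f"
begin

definition seminorm :: "('a \<Rightarrow> real) \<Rightarrow> real" where
  "seminorm f = sqrt (ip f f)"

lemma seminorm_nonneg: "f \<in> V \<Longrightarrow> 0 \<le> seminorm f"
  by (simp add: seminorm_def ip_nonneg)

lemma seminorm_square: "f \<in> V \<Longrightarrow> (seminorm f)\<^sup>2 = ip f f"
  by (simp add: seminorm_def ip_nonneg)

lemma add_mem: "f \<in> V \<Longrightarrow> g \<in> V \<Longrightarrow> (\<lambda>x. f x + g x) \<in> V"
  using lincomb[of f g 1 1] by simp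

lemma diff_mem: "f \<in> V \<Longrightarrow> g \<in> V \<Longrightarrow> (\<lambda>x. f x - g x) \<in> V"
  using lincomb[of f g 1 "-1"] by simp

lemma scale_mem: "f \<in> V \<Longrightarrow> (\<lambda>x. s * f x) \<in> V"
  using lincomb[of f f s 0] by simp

lemma ip_add: "f \<in> V \<Longrightarrow> g \<in> V \<Longrightarrow> h \<in> V \<Longrightarrow> ip (\<lambda>x. f x + g x) h = ip f h + ip g h"
  using ip_lincomb[of f g h 1 1] by simp

lemma ip_diff: "f \<in> V \<Longrightarrow> g \<in> V \<Longrightarrow> h \<in> V \<Longrightarrow> ip (\<lambda>x. f x - g x) h = ip f h - ip g h"
  using ip_lincomb[of f g h 1 "-1"] by simp

lemma ip_scale: "f \<in> V \<Longrightarrow> h \<in> V \<Longrightarrow> ip (\<lambda>x. s * f x) h = s * ip f h"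
  using ip_lincomb[of f f h s 0] by simp

lemma ip_lincomb_square:
  assumes "f \<in> V" "g \<in> V"
  shows "ip (\<lambda>x. p * f x + q * g x) (\<lambda>x. p * f x + q * g x)
         = p\<^sup>2 * ip f f + 2 * p * q * ip f g + q\<^sup>2 * ip g g"
  using assms ip_commute[OF assms(2) lincomb[OF assms]] ip_commute[OF assms(1) lincomb[OF assms]]
    ip_commute[OF assms]
  by (simp add: ip_lincomb lincomb power2_eq_square algebra_simps)

lemma seminorm_diff_square:
  "f \<in> V \<Longrightarrow> g \<in> V \<Longrightarrow> (seminorm (\<lambda>x. f x - g x))\<^sup>2 = ip f f - 2 * ip f g + ip g g"
  using ip_lincomb_square[of f g 1 "-1"] by (simp add: seminorm_square diff_mem)

lemma seminorm_add_square:
  "f \<in> V \<Longrightarrow> g \<in> V \<Longrightarrow> (seminorm (\<lambda>x. f x + g x))\<^sup>2 = ip f f + 2 * ip f g + ip g g"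
  using ip_lincomb_square[of f g 1 1] by (simp add: seminorm_square add_mem)

lemma seminorm_scale:
  assumes "f \<in> V" shows "seminorm (\<lambda>x. s * f x) = \<bar>s\<bar> * seminorm f"
  using ip_lincomb_square[OF assms assms, of s 0]
  by (simp add: seminorm_def real_sqrt_mult)

lemma seminorm_minus_commute:
  assumes "f \<in> V" "g \<in> V" shows "seminorm (\<lambda>x. f x - g x) = seminorm (\<lambda>x. g x - f x)"
  using seminorm_scale[OF diff_mem[OF assms], of "-1"] by simp

lemma Cauchy_Schwarz:
  assumes f: "f \<in> V" and g: "g \<in> V"
  shows "\<bar>ip f g\<bar> \<le> seminorm f * seminorm g"
proof -
  have pos: "0 \<le> p\<^sup>2 * ip f f + 2 * p * q * ip f g + q\<^sup>2 * ip g g" for p q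
    using ip_nonneg[OF lincomb[OF f g, of p q]] ip_lincomb_square[OF f g, of p q] by simp
  have "(ip f g)\<^sup>2 \<le> ip f f * ip g g"
  proof (cases "ip g g = 0")
    case True
    have "ip f g = 0"
    proof (rule ccontr)
      assume "ip f g \<noteq> 0"
      then show False
        \<comment> \<open>if \<open>g\<close> has seminorm zero, the quadratic form is affine in \<open>q\<close>; this choice makes it equal to \<open>-1\<close>\<close>
        using pos[of 1 "- (ip f f + 1) / (2 * ip f g)"] True by (simp add: field_simps)
    qed
    then show ?thesis using True by simp
  next
    case False
    then have "ip g g > 0" using ip_nonneg[OF g] by simp
    \<comment> \<open>expand the square of \<open>\<langle>g,g\<rangle> f - \<langle>f,g\<rangle> g\<close>, a multiple of the component of \<open>f\<close> orthogonal to \<open>g\<close>\<close>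
    moreover have "0 \<le> ip g g * (ip f f * ip g g - (ip f g)\<^sup>2)"
      using pos[of "ip g g" "- ip f g"] by (simp add: power2_eq_square algebra_simps)
    ultimately show ?thesis
      by (simp add: zero_le_mult_iff)
  qed
  then have "sqrt ((ip f g)\<^sup>2) \<le> sqrt (ip f f * ip g g)"
    by (rule real_sqrt_le_mono)
  then show ?thesis
    by (simp add: seminorm_def real_sqrt_mult)
qed

lemma ip_le: "f \<in> V \<Longrightarrow> g \<in> V \<Longrightarrow> ip f g \<le> seminorm f * seminorm g"
  using Cauchy_Schwarz[of f g] by linarith

lemma seminorm_diff_triangle:
  assumes f: "f \<in> V" and g: "g \<in> V"
  shows "seminorm (\<lambda>x. f x - g x) \<le> seminorm f + seminorm g"
proof (rule power2_le_imp_le)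
  show "(seminorm (\<lambda>x. f x - g x))\<^sup>2 \<le> (seminorm f + seminorm g)\<^sup>2"
    using Cauchy_Schwarz[OF f g] seminorm_square[OF f] seminorm_square[OF g]
    by (simp add: seminorm_diff_square f g power2_sum)
  show "0 \<le> seminorm f + seminorm g"
    using seminorm_nonneg f g by simp
qed

end

section \<open>Square-integrable and Sobolev functions\<close>

lemma integrable_L2_mult:
  assumes "f \<in> L2 S" "g \<in> L2 S"
  shows "integrable (lebesgue_on S) (\<lambda>x. f x * g x)"
proof (rule Bochner_Integration.integrable_bound)
  show "integrable (lebesgue_on S) (\<lambda>x. (f x)\<^sup>2 + (g x)\<^sup>2)"
    "(\<lambda>x. f x * g x) \<in> borel_measurable (lebesgue_on S)"
    using assms by (auto simp: L2_def)
  have "norm (f x * g x) \<le> norm ((f x)\<^sup>2 + (g x)\<^sup>2)" for x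
  proof -
    have "2 * (\<bar>f x\<bar> * \<bar>g x\<bar>) \<le> (f x)\<^sup>2 + (g x)\<^sup>2"
      using sum_squares_bound[of "\<bar>f x\<bar>" "\<bar>g x\<bar>"] by simp
    moreover have "0 \<le> \<bar>f x\<bar> * \<bar>g x\<bar>" by simp
    ultimately show ?thesis unfolding real_norm_def abs_mult by linarith
  qed
  then show "AE x in lebesgue_on S. norm (f x * g x) \<le> norm ((f x)\<^sup>2 + (g x)\<^sup>2)"
    by simp
qed

lemma L2_lincomb:
  assumes "f \<in> L2 S" "g \<in> L2 S"
  shows "(\<lambda>x. p * f x + q * g x) \<in> L2 S"
proof -
  have "(\<lambda>x. (p * f x + q * g x)\<^sup>2) = (\<lambda>x. p\<^sup>2 * (f x * f x) + 2 * p * q * (f x * g x) + q\<^sup>2 * (g x * g x))"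
    by (auto simp: power2_eq_square algebra_simps)
  moreover have "integrable (lebesgue_on S)
      (\<lambda>x. p\<^sup>2 * (f x * f x) + 2 * p * q * (f x * g x) + q\<^sup>2 * (g x * g x))"
    using assms by (intro Bochner_Integration.integrable_add integrable_mult_right integrable_L2_mult)
  ultimately show ?thesis
    using assms by (auto simp: L2_def)
qed

lemma l2_inner_lincomb:
  assumes "f \<in> L2 S" "g \<in> L2 S" "h \<in> L2 S"
  shows "l2_inner S (\<lambda>x. p * f x + q * g x) h = p * l2_inner S f h + q * l2_inner S g h"
proof -
  have "(\<lambda>x. (p * f x + q * g x) * h x) = (\<lambda>x. p * (f x * h x) + q * (g x * h x))"
    by (auto simp: algebra_simps)
  then show ?thesis
    unfolding l2_inner_def using assms
    by (simp add: integrable_L2_mult)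
qed

interpretation L2: semi_inner_product_space "L2 S" "l2_inner S"
  rewrites "semi_inner_product_space.seminorm (l2_inner S) = l2_norm S" for S
proof -
  show *: "semi_inner_product_space (L2 S) (l2_inner S)"
  proof
    show "l2_inner S f g = l2_inner S g f" for f g
      by (simp add: l2_inner_def mult.commute)
    show "0 \<le> l2_inner S f f" for f
      by (simp add: l2_inner_def)
  qed (auto intro: L2_lincomb l2_inner_lincomb)
  show "semi_inner_product_space.seminorm (l2_inner S) = l2_norm S"
    by (auto simp: semi_inner_product_space.seminorm_def[OF *] l2_norm_def)
qed

lemma l2_inner_cong_AE:
  assumes "f \<in> L2 S" "f' \<in> L2 S" "g \<in> L2 S" "AE x in lebesgue_on S. f x = f' x"
  shows "l2_inner S f g = l2_inner S f' g"
  unfolding l2_inner_def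
  by (rule integral_cong_AE) (use assms in \<open>auto simp: L2_def elim!: eventually_mono\<close>)

text \<open>The chosen representative agrees almost everywhere with some square-integrable weak derivative,
which exists by the definition of the Sobolev space.\<close>

lemma sobolev_weak_deriv:
  assumes f: "f \<in> sobolev k l r" and j: "j \<le> k"
  shows "has_weak_deriv j {l<..<r} f (weak_deriv j {l<..<r} f)"
    and "weak_deriv j {l<..<r} f \<in> L2 {l<..<r}"
proof -
  obtain g where g: "g \<in> L2 {l<..<r}" "has_weak_deriv j {l<..<r} f g"
    using f j unfolding sobolev_def by blast
  show "has_weak_deriv j {l<..<r} f (weak_deriv j {l<..<r} f)"
    unfolding weak_deriv_def using g(2)
    by (rule someI[of "has_weak_deriv j {l<..<r} f"])
  have ae: "AE x in lebesgue_on {l<..<r}. g x = weak_deriv j {l<..<r} f x"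
    using weak_deriv_AE[OF _ g(2)] by (auto elim: eventually_mono)
  have m: "weak_deriv j {l<..<r} f \<in> borel_measurable (lebesgue_on {l<..<r})"
    by (rule measurable_lebesgue_on_AE[OF _ _ ae]) (use g in \<open>auto simp: L2_def\<close>)
  have "integrable (lebesgue_on {l<..<r}) (\<lambda>x. (weak_deriv j {l<..<r} f x)\<^sup>2)"
    by (rule integrable_cong_AE_imp[of _ "\<lambda>x. (g x)\<^sup>2"])
       (use g m ae in \<open>auto simp: L2_def elim!: eventually_mono\<close>)
  with m show "weak_deriv j {l<..<r} f \<in> L2 {l<..<r}"
    by (simp add: L2_def)
qed

lemma sobolev_lincomb:
  assumes "f \<in> sobolev k l r" "g \<in> sobolev k l r"
  shows "(\<lambda>x. p * f x + q * g x) \<in> sobolev k l r"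
proof -
  have "continuous_on {l..r} (\<lambda>x. p * f x + q * g x)"
    using assms by (auto simp: sobolev_def intro!: continuous_intros)
  moreover have "\<exists>h\<in>L2 {l<..<r}. has_weak_deriv j {l<..<r} (\<lambda>x. p * f x + q * g x) h" if "j \<le> k" for j
  proof (rule bexI)
    show "has_weak_deriv j {l<..<r} (\<lambda>x. p * f x + q * g x)
        (\<lambda>x. p * weak_deriv j {l<..<r} f x + q * weak_deriv j {l<..<r} g x)"
      by (rule has_weak_deriv_lincomb[OF _ sobolev_weak_deriv(1)[OF assms(1) that]
            sobolev_weak_deriv(1)[OF assms(2) that]]) simp
    show "(\<lambda>x. p * weak_deriv j {l<..<r} f x + q * weak_deriv j {l<..<r} g x) \<in> L2 {l<..<r}"
      by (rule L2_lincomb[OF sobolev_weak_deriv(2)[OF assms(1) that]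
            sobolev_weak_deriv(2)[OF assms(2) that]])
  qed
  ultimately show ?thesis
    unfolding sobolev_def by auto
qed

lemma sobolev_inner_lincomb:
  assumes f: "f \<in> sobolev k l r" and g: "g \<in> sobolev k l r" and h: "h \<in> sobolev k l r"
  shows "sobolev_inner k {l<..<r} (\<lambda>x. p * f x + q * g x) h
         = p * sobolev_inner k {l<..<r} f h + q * sobolev_inner k {l<..<r} g h"
proof -
  let ?S = "{l<..<r}"
  have "l2_inner ?S (weak_deriv j ?S (\<lambda>x. p * f x + q * g x)) (weak_deriv j ?S h)
      = p * l2_inner ?S (weak_deriv j ?S f) (weak_deriv j ?S h)
        + q * l2_inner ?S (weak_deriv j ?S g) (weak_deriv j ?S h)" if j: "j \<le> k" for j
  proof -
    have "l2_inner ?S (weak_deriv j ?S (\<lambda>x. p * f x + q * g x)) (weak_deriv j ?S h)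
       = l2_inner ?S (\<lambda>x. p * weak_deriv j ?S f x + q * weak_deriv j ?S g x) (weak_deriv j ?S h)"
      by (intro l2_inner_cong_AE sobolev_weak_deriv(2)[OF sobolev_lincomb[OF f g] j] L2_lincomb
            sobolev_weak_deriv(2)[OF f j] sobolev_weak_deriv(2)[OF g j] sobolev_weak_deriv(2)[OF h j]
            weak_deriv_lincomb_AE[OF _ sobolev_weak_deriv(1)[OF f j] sobolev_weak_deriv(1)[OF g j]])
         simp
    also have "\<dots> = p * l2_inner ?S (weak_deriv j ?S f) (weak_deriv j ?S h)
        + q * l2_inner ?S (weak_deriv j ?S g) (weak_deriv j ?S h)"
      by (intro l2_inner_lincomb sobolev_weak_deriv(2)[OF f j] sobolev_weak_deriv(2)[OF g j]
            sobolev_weak_deriv(2)[OF h j])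
    finally show ?thesis .
  qed
  then show ?thesis
    by (simp add: sobolev_inner_def sum.distrib sum_distrib_left)
qed

interpretation sobolev: semi_inner_product_space "sobolev k l r" "sobolev_inner k {l<..<r}"
  rewrites "semi_inner_product_space.seminorm (sobolev_inner k {l<..<r}) = sobolev_norm k {l<..<r}"
  for k l r
proof -
  show *: "semi_inner_product_space (sobolev k l r) (sobolev_inner k {l<..<r})"
  proof
    show "sobolev_inner k {l<..<r} f g = sobolev_inner k {l<..<r} g f" for f g
      by (simp add: sobolev_inner_def l2_inner_def mult.commute)
    show "0 \<le> sobolev_inner k {l<..<r} f f" for f
      by (auto simp: sobolev_inner_def l2_inner_def intro!: sum_nonneg)
  qed (auto intro: sobolev_lincomb sobolev_inner_lincomb)
  show "semi_inner_product_space.seminorm (sobolev_inner k {l<..<r}) = sobolev_norm k {l<..<r}"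
    by (auto simp: semi_inner_product_space.seminorm_def[OF *] sobolev_norm_def)
qed

lemma sobolev_inner_cong:
  assumes "\<And>x. x \<in> S \<Longrightarrow> f x = f' x"
  shows "sobolev_inner k S f g = sobolev_inner k S f' g"
  using weak_deriv_cong[of S f f', OF assms] by (simp add: sobolev_inner_def)

section \<open>Convexity of the set of admissible parameters\<close>

lemma Linf_loc_lincomb:
  assumes f: "Linf_loc f" and g: "Linf_loc g"
  shows "Linf_loc (\<lambda>x. p * f x + q * g x)"
  unfolding Linf_loc_def
proof (intro conjI allI impI)
  show "(\<lambda>x. p * f x + q * g x) \<in> borel_measurable lebesgue"
    using f g unfolding Linf_loc_def by (intro borel_measurable_add borel_measurable_times borel_measurable_const) auto
  fix K :: "real set" assume "compact K"
  then obtain M N where "AE x in lebesgue_on K. \<bar>f x\<bar> \<le> M" "AE x in lebesgue_on K. \<bar>g x\<bar> \<le> N"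
    using f g unfolding Linf_loc_def by blast
  then have "AE x in lebesgue_on K. \<bar>p * f x + q * g x\<bar> \<le> \<bar>p\<bar> * M + \<bar>q\<bar> * N"
  proof eventually_elim
    case (elim x)
    have "\<bar>p * f x + q * g x\<bar> \<le> \<bar>p\<bar> * \<bar>f x\<bar> + \<bar>q\<bar> * \<bar>g x\<bar>"
      using abs_triangle_ineq[of "p * f x" "q * g x"] by (simp add: abs_mult)
    also have "\<dots> \<le> \<bar>p\<bar> * M + \<bar>q\<bar> * N"
      using elim by (intro add_mono mult_left_mono) auto
    finally show ?case .
  qed
  then show "\<exists>M. AE x in lebesgue_on K. \<bar>p * f x + q * g x\<bar> \<le> M" by blast
qed

lemma W_inf_loc_lincomb:
  assumes "W_inf_loc k f" "W_inf_loc k g"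
  shows "W_inf_loc k (\<lambda>x. p * f x + q * g x)"
  unfolding W_inf_loc_def
proof (intro allI impI)
  fix j assume "j \<le> k"
  then obtain f' g' where "has_weak_deriv j UNIV f f'" "Linf_loc f'" "has_weak_deriv j UNIV g g'" "Linf_loc g'"
    using assms unfolding W_inf_loc_def by blast
  then have "has_weak_deriv j UNIV (\<lambda>x. p * f x + q * g x) (\<lambda>x. p * f' x + q * g' x)
       \<and> Linf_loc (\<lambda>x. p * f' x + q * g' x)"
    by (intro conjI has_weak_deriv_lincomb Linf_loc_lincomb) simp_all
  then show "\<exists>h. has_weak_deriv j UNIV (\<lambda>x. p * f x + q * g x) h \<and> Linf_loc h" by blast
qed

lemma condA1_convex:
  assumes f: "condA1 a0 a1 a2 a3 f" and g: "condA1 a0 a1 a2 a3 g" and s: "0 \<le> s" "s \<le> 1"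
  shows "condA1 a0 a1 a2 a3 (\<lambda>x. (1 - s) * f x + s * g x)"
proof -
  have W: "W_inf_loc 3 f" "W_inf_loc 3 g"
    using f g by (auto simp: condA1_def)
  have lin: "AE x in lebesgue. weak_deriv j UNIV (\<lambda>x. (1 - s) * f x + s * g x) x
      = (1 - s) * weak_deriv j UNIV f x + s * weak_deriv j UNIV g x" if "j \<le> 3" for j
  proof -
    obtain f' g' where "has_weak_deriv j UNIV f f'" "has_weak_deriv j UNIV g g'"
      using W \<open>j \<le> 3\<close> unfolding W_inf_loc_def by blast
    from weak_deriv_lincomb_AE[OF open_UNIV this, of "1 - s" s] show ?thesis
      unfolding lebesgue_on_UNIV_eq .
  qed
  have convex_bound: "\<bar>(1 - s) * u + s * v\<bar> \<le> M" if "\<bar>u\<bar> \<le> M" "\<bar>v\<bar> \<le> M" for u v M :: real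
    using convex_bound_le[of u M v "1 - s" s] convex_bound_le[of "-u" M "-v" "1 - s" s] that s
    by (auto simp: abs_le_iff)
  have "AE x in lebesgue. a0 \<le> weak_deriv 1 UNIV f x \<and> weak_deriv 1 UNIV f x \<le> a1"
    "AE x in lebesgue. a0 \<le> weak_deriv 1 UNIV g x \<and> weak_deriv 1 UNIV g x \<le> a1"
    using f g unfolding condA1_def by blast+
  moreover have "AE x in lebesgue. weak_deriv 1 UNIV (\<lambda>x. (1 - s) * f x + s * g x) x
      = (1 - s) * weak_deriv 1 UNIV f x + s * weak_deriv 1 UNIV g x"
    by (rule lin) simp
  ultimately have 1: "AE x in lebesgue. a0 \<le> weak_deriv 1 UNIV (\<lambda>x. (1 - s) * f x + s * g x) x
      \<and> weak_deriv 1 UNIV (\<lambda>x. (1 - s) * f x + s * g x) x \<le> a1"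
  proof eventually_elim
    case (elim x)
    then show ?case
      using s convex_bound_le[of "weak_deriv 1 UNIV f x" a1 "weak_deriv 1 UNIV g x" "1 - s" s]
        convex_bound_le[of "- weak_deriv 1 UNIV f x" "- a0" "- weak_deriv 1 UNIV g x" "1 - s" s]
      by auto
  qed
  have bounds: "AE x in lebesgue. \<bar>weak_deriv j UNIV (\<lambda>x. (1 - s) * f x + s * g x) x\<bar> \<le> M"
    if "j \<le> 3" "AE x in lebesgue. \<bar>weak_deriv j UNIV f x\<bar> \<le> M"
       "AE x in lebesgue. \<bar>weak_deriv j UNIV g x\<bar> \<le> M" for j M
    using lin[OF that(1)] that(2,3) by eventually_elim (simp add: convex_bound)
  have 2: "AE x in lebesgue. \<bar>weak_deriv 2 UNIV (\<lambda>x. (1 - s) * f x + s * g x) x\<bar> \<le> a2"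
    by (rule bounds) (use f g in \<open>simp_all add: condA1_def\<close>)
  have 3: "AE x in lebesgue. \<bar>weak_deriv 3 UNIV (\<lambda>x. (1 - s) * f x + s * g x) x\<bar> \<le> a3"
    by (rule bounds) (use f g in \<open>simp_all add: condA1_def\<close>)
  have "continuous_on UNIV (\<lambda>x. (1 - s) * f x + s * g x)"
    by (intro continuous_intros) (use f g in \<open>simp_all add: condA1_def\<close>)
  with 1 2 3 W_inf_loc_lincomb[OF W] show ?thesis
    using f g unfolding condA1_def by simp
qed

text \<open>The extensions to the whole line that witness admissibility of the two end points can be combined
with the same weights. The segment is written in the form in which it serves as a path of
parameters with constant velocity \<open>b - a\<close>.\<close>

lemma admissible_convex:
  assumes a: "a \<in> admissible a0 a1 a2 a3 lo hi" and b: "b \<in> admissible a0 a1 a2 a3 lo hi"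
    and s: "0 \<le> s" "s \<le> 1"
  shows "(\<lambda>y. a y + s * (b y - a y)) \<in> admissible a0 a1 a2 a3 lo hi"
proof -
  obtain a' b' where a': "condA1 a0 a1 a2 a3 a'" "\<forall>y\<in>{lo..hi}. a y = a' y"
    and b': "condA1 a0 a1 a2 a3 b'" "\<forall>y\<in>{lo..hi}. b y = b' y"
    using a b unfolding admissible_def by blast
  have "(\<lambda>y. (1 - s) * a y + s * b y) \<in> admissible a0 a1 a2 a3 lo hi"
    unfolding admissible_def
  proof (intro CollectI conjI exI)
    show "(\<lambda>y. (1 - s) * a y + s * b y) \<in> sobolev 2 lo hi"
      using a b by (intro sobolev_lincomb) (auto simp: admissible_def)
    show "condA1 a0 a1 a2 a3 (\<lambda>y. (1 - s) * a' y + s * b' y)"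
      by (rule condA1_convex[OF a'(1) b'(1) s])
    show "\<forall>y\<in>{lo..hi}. (1 - s) * a y + s * b y = (1 - s) * a' y + s * b' y"
      using a'(2) b'(2) by simp
  qed
  also have "(\<lambda>y. (1 - s) * a y + s * b y) = (\<lambda>y. a y + s * (b y - a y))"
    by (auto simp: algebra_simps)
  finally show ?thesis .
qed

section \<open>The Taylor remainder of the forward operator\<close>

text \<open>The operator norm is a supremum of real numbers, so boundedness of the quotients must be known
before it bounds any of them. Directions of norm zero contribute the quotient \<open>0\<close>, since
\<open>x / 0 = 0\<close>, and must be treated separately: there boundedness of the operators forces
the left-hand side to vanish.\<close>

lemma opnorm_H2_L2_bound:
  assumes A: "bounded_linear_H2_L2 lo hi T A" and B: "bounded_linear_H2_L2 lo hi T B"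
    and d: "d \<in> sobolev 2 lo hi"
  shows "l2_norm {0<..<T} (\<lambda>t. A d t - B d t)
         \<le> opnorm_H2_L2 lo hi T (\<lambda>b t. A b t - B b t) * sobolev_norm 2 {lo<..<hi} d"
proof -
  let ?N = "sobolev_norm 2 {lo<..<hi}"
  let ?D = "\<lambda>b. l2_norm {0<..<T} (\<lambda>t. A b t - B b t)"
  obtain K where K: "\<And>b. b \<in> sobolev 2 lo hi \<Longrightarrow> l2_norm {0<..<T} (A b) \<le> K * ?N b"
    using A unfolding bounded_linear_H2_L2_def by blast
  obtain K' where K': "\<And>b. b \<in> sobolev 2 lo hi \<Longrightarrow> l2_norm {0<..<T} (B b) \<le> K' * ?N b"
    using B unfolding bounded_linear_H2_L2_def by blast
  have D: "?D b \<le> (K + K') * ?N b" if "b \<in> sobolev 2 lo hi" for b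
  proof -
    have "A b \<in> L2 {0<..<T}" "B b \<in> L2 {0<..<T}"
      using A B that by (auto simp: bounded_linear_H2_L2_def)
    from L2.seminorm_diff_triangle[OF this] K[OF that] K'[OF that] show ?thesis
      by (simp add: algebra_simps)
  qed
  show ?thesis
  proof (cases "?N d = 0")
    case True
    with D[OF d] show ?thesis by simp
  next
    case False
    then have pos: "?N d > 0"
      using sobolev.seminorm_nonneg[OF d] by simp
    have "bdd_above ((\<lambda>b. ?D b / ?N b) ` sobolev 2 lo hi)"
    proof (rule bdd_aboveI2)
      fix b assume b: "b \<in> sobolev 2 lo hi"
      show "?D b / ?N b \<le> max 0 (K + K')"
      proof (cases "?N b = 0")
        case False
        then have "?N b > 0" using sobolev.seminorm_nonneg[OF b] by simp
        then have "?D b / ?N b \<le> K + K'" using D[OF b] by (simp add: divide_le_eq)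
        then show ?thesis by simp
      qed simp
    qed
    then have "?D d / ?N d \<le> opnorm_H2_L2 lo hi T (\<lambda>b t. A b t - B b t)"
      unfolding opnorm_H2_L2_def by (rule cSUP_upper[OF d])
    with pos show ?thesis by (simp add: divide_le_eq)
  qed
qed

text \<open>Pairing with a fixed \<open>w\<close> turns the operator along a segment into a real function of one
variable, to which the mean value theorem applies. The derivative is one-sided at the end points,
because the Frechet derivative is only relative to \<open>D\<close>.\<close>

lemma frechet_rel_curve_derivative:
  assumes fr: "frechet_rel lo hi T D F F'" and w: "w \<in> L2 {0<..<T}"
    and seg: "\<And>s. s \<in> {0..1} \<Longrightarrow> (\<lambda>y. a y + s * d y) \<in> D"
    and d: "d \<in> sobolev 2 lo hi" and s: "s \<in> {0..1}"
  shows "((\<lambda>s. l2_inner {0<..<T} (F (\<lambda>y. a y + s * d y)) w) has_real_derivative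
            l2_inner {0<..<T} (F' (\<lambda>y. a y + s * d y) d) w) (at s within {0..1})"
  unfolding has_field_derivative_def has_derivative_within_alt
proof (intro conjI allI impI bounded_linear_mult_right)
  let ?c = "\<lambda>s y. a y + s * d y"
  let ?I = "l2_inner {0<..<T}" and ?N = "l2_norm {0<..<T}" and ?H = "sobolev_norm 2 {lo<..<hi}"
  fix e :: real assume e: "e > 0"
  \<comment> \<open>the summand \<open>1\<close> here and in the radius below only avoids a division by zero\<close>
  define M where "M = ?H d * ?N w + 1"
  have Hd: "?H d \<ge> 0" and Nw: "?N w \<ge> 0"
    using sobolev.seminorm_nonneg[OF d] L2.seminorm_nonneg[OF w] by auto
  then have M: "M > 0" "?H d * ?N w \<le> M" unfolding M_def by (auto intro: add_nonneg_pos)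
  have bl: "bounded_linear_H2_L2 lo hi T (F' (?c s))" and FL: "F (?c t) \<in> L2 {0<..<T}" if "t \<in> {0..1}" for t
    using fr seg[OF s] seg[OF that] unfolding frechet_rel_def by blast+
  have F'L: "F' (?c s) b \<in> L2 {0<..<T}" if "b \<in> sobolev 2 lo hi" for b
    using bl[OF s] that by (simp add: bounded_linear_H2_L2_def)
  have "e / M > 0" using e M by simp
  then obtain \<eta> where \<eta>: "\<eta> > 0" and est: "\<And>b. b \<in> D \<Longrightarrow> ?H (\<lambda>y. b y - ?c s y) < \<eta> \<Longrightarrow>
      ?N (\<lambda>t. F b t - F (?c s) t - F' (?c s) (\<lambda>y. b y - ?c s y) t) \<le> e / M * ?H (\<lambda>y. b y - ?c s y)"
    using fr seg[OF s] unfolding frechet_rel_def by meson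
  show "\<exists>\<delta>>0. \<forall>t\<in>{0..1}. norm (t - s) < \<delta> \<longrightarrow>
      norm (?I (F (?c t)) w - ?I (F (?c s)) w - ?I (F' (?c s) d) w * (t - s)) \<le> e * norm (t - s)"
  proof (intro exI[of _ "\<eta> / (?H d + 1)"] conjI ballI impI)
    show "\<eta> / (?H d + 1) > 0" using \<eta> Hd by simp
    fix t :: real assume t: "t \<in> {0..1}" and near: "norm (t - s) < \<eta> / (?H d + 1)"
    have diff: "(\<lambda>y. ?c t y - ?c s y) = (\<lambda>y. (t - s) * d y)"
      by (auto simp: algebra_simps)
    have Hdiff: "?H (\<lambda>y. (t - s) * d y) = \<bar>t - s\<bar> * ?H d"
      by (rule sobolev.seminorm_scale[OF d])
    have "\<bar>t - s\<bar> * ?H d \<le> \<bar>t - s\<bar> * (?H d + 1)" by (simp add: mult_left_mono)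
    also have "\<dots> < \<eta>" using near Hd by (simp add: less_divide_eq)
    finally have R: "?N (\<lambda>x. F (?c t) x - F (?c s) x - F' (?c s) (\<lambda>y. (t - s) * d y) x)
        \<le> e / M * (\<bar>t - s\<bar> * ?H d)"
      using est[OF seg[OF t]] unfolding diff Hdiff by blast
    note td = sobolev.scale_mem[OF d, of "t - s"]
    note RL = L2.diff_mem[OF L2.diff_mem[OF FL[OF t] FL[OF s]] F'L[OF td]]
    have "?I (F' (?c s) (\<lambda>y. (t - s) * d y)) w = ?I (\<lambda>x. (t - s) * F' (?c s) d x) w"
      using bl[OF s] d unfolding bounded_linear_H2_L2_def
      by (intro l2_inner_cong_AE F'L td L2.scale_mem d w) blast
    also have "\<dots> = (t - s) * ?I (F' (?c s) d) w"
      by (rule L2.ip_scale[OF F'L[OF d] w])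
    finally have "?I (F (?c t)) w - ?I (F (?c s)) w - ?I (F' (?c s) d) w * (t - s)
        = ?I (\<lambda>x. F (?c t) x - F (?c s) x - F' (?c s) (\<lambda>y. (t - s) * d y) x) w"
      by (simp add: L2.ip_diff[OF L2.diff_mem[OF FL[OF t] FL[OF s]] F'L[OF td] w]
            L2.ip_diff[OF FL[OF t] FL[OF s] w])
    then have "norm (?I (F (?c t)) w - ?I (F (?c s)) w - ?I (F' (?c s) d) w * (t - s))
        \<le> ?N (\<lambda>x. F (?c t) x - F (?c s) x - F' (?c s) (\<lambda>y. (t - s) * d y) x) * ?N w"
      using L2.Cauchy_Schwarz[OF RL w] by simp
    also have "\<dots> \<le> e / M * (\<bar>t - s\<bar> * ?H d) * ?N w"
      by (rule mult_right_mono[OF R Nw])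
    also have "\<dots> = e * \<bar>t - s\<bar> * (?H d * ?N w / M)" by simp
    also have "\<dots> \<le> e * \<bar>t - s\<bar> * 1"
      using M e by (intro mult_left_mono) auto
    finally show "norm (?I (F (?c t)) w - ?I (F (?c s)) w - ?I (F' (?c s) d) w * (t - s)) \<le> e * norm (t - s)"
      by simp
  qed
qed

text \<open>Only the component of the remainder in the direction \<open>w\<close> is needed. Along the segment
\<open>a + s d\<close> its slope is \<open>\<langle>(F'(a + s d) - F'(a)) d, w\<rangle>\<close>, which is at most
\<open>L s \<parallel>d\<parallel>\<^sup>2 \<parallel>w\<parallel>\<close>; integrating over \<open>s\<close> from \<open>0\<close> to \<open>1\<close> produces the
factor one half. No integral is formed: the function \<open>k\<close> below, the component minus its
claimed bound at \<open>s\<close>, has nonpositive derivative.\<close>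

lemma taylor_remainder:
  assumes fr: "frechet_rel lo hi T D F F'" and w: "w \<in> L2 {0<..<T}"
    and conv: "\<And>a b s. a \<in> D \<Longrightarrow> b \<in> D \<Longrightarrow> 0 \<le> s \<Longrightarrow> s \<le> 1 \<Longrightarrow> (\<lambda>y. a y + s * (b y - a y)) \<in> D"
    and D: "D \<subseteq> sobolev 2 lo hi"
    and lip: "\<And>a b. a \<in> D \<Longrightarrow> b \<in> D \<Longrightarrow> opnorm_H2_L2 lo hi T (\<lambda>h t. F' a h t - F' b h t)
          \<le> L * sobolev_norm 2 {lo<..<hi} (\<lambda>y. a y - b y)"
    and a: "a \<in> D" and b: "b \<in> D"
  shows "l2_inner {0<..<T} (F b) w - l2_inner {0<..<T} (F a) w
           - l2_inner {0<..<T} (F' a (\<lambda>y. b y - a y)) w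
         \<le> L / 2 * l2_norm {0<..<T} w * (sobolev_norm 2 {lo<..<hi} (\<lambda>y. b y - a y))\<^sup>2"
proof -
  define d where "d = (\<lambda>y. b y - a y)"
  let ?c = "\<lambda>s y. a y + s * d y"
  let ?I = "l2_inner {0<..<T}" and ?N = "l2_norm {0<..<T}" and ?H = "sobolev_norm 2 {lo<..<hi}"
  have d: "d \<in> sobolev 2 lo hi"
    unfolding d_def using a b D by (intro sobolev.diff_mem) auto
  have seg: "?c s \<in> D" if "s \<in> {0..1}" for s
    unfolding d_def using that by (intro conv a b) auto
  have Nw: "?N w \<ge> 0" by (rule L2.seminorm_nonneg[OF w])
  have slope: "?I (F' (?c s) d) w - ?I (F' a d) w \<le> L * s * (?H d)\<^sup>2 * ?N w" if s: "s \<in> {0..1}" for s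
  proof -
    have bl: "bounded_linear_H2_L2 lo hi T (F' (?c s))" "bounded_linear_H2_L2 lo hi T (F' a)"
      using fr seg[OF s] a unfolding frechet_rel_def by blast+
    then have L2s: "F' (?c s) d \<in> L2 {0<..<T}" "F' a d \<in> L2 {0<..<T}"
      using d by (auto simp: bounded_linear_H2_L2_def)
    have "?N (\<lambda>t. F' (?c s) d t - F' a d t)
        \<le> opnorm_H2_L2 lo hi T (\<lambda>h t. F' (?c s) h t - F' a h t) * ?H d"
      by (rule opnorm_H2_L2_bound[OF bl d])
    also have "\<dots> \<le> L * ?H (\<lambda>y. ?c s y - a y) * ?H d"
      by (rule mult_right_mono[OF lip[OF seg[OF s] a] sobolev.seminorm_nonneg[OF d]])
    also have "?H (\<lambda>y. ?c s y - a y) = s * ?H d"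
      using sobolev.seminorm_scale[OF d, of s] s by simp
    finally have N: "?N (\<lambda>t. F' (?c s) d t - F' a d t) \<le> L * s * (?H d)\<^sup>2"
      by (simp add: power2_eq_square mult_ac)
    have "?I (F' (?c s) d) w - ?I (F' a d) w = ?I (\<lambda>t. F' (?c s) d t - F' a d t) w"
      by (rule L2.ip_diff[OF L2s w, symmetric])
    also have "\<dots> \<le> ?N (\<lambda>t. F' (?c s) d t - F' a d t) * ?N w"
      by (rule L2.ip_le[OF L2.diff_mem[OF L2s] w])
    also have "\<dots> \<le> L * s * (?H d)\<^sup>2 * ?N w"
      by (rule mult_right_mono[OF N Nw])
    finally show ?thesis .
  qed
  define k where "k s = ?I (F (?c s)) w - s * ?I (F' a d) w - L * (?H d)\<^sup>2 * ?N w * s\<^sup>2 / 2" for s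
  define k' where "k' s = ?I (F' (?c s) d) w - ?I (F' a d) w - L * (?H d)\<^sup>2 * ?N w * s" for s
  have "(k has_derivative (\<lambda>h. k' s * h)) (at s within {0..1})" if "s \<in> {0..1}" for s
  proof -
    have "(k has_real_derivative k' s) (at s within {0..1})"
      unfolding k_def k'_def
      by (rule derivative_eq_intros frechet_rel_curve_derivative[OF fr w seg d that] refl | simp)+
    then show ?thesis by (simp add: has_field_derivative_def)
  qed
  then obtain s where s: "s \<in> {0<..<1}" "k 1 - k 0 = k' s * (1 - 0)"
    using mvt_simple[of 0 1 k "\<lambda>s h. k' s * h"] by auto
  have "k' s \<le> 0"
    using slope[of s] s(1) by (simp add: k'_def mult_ac)
  with s(2) have "k 1 \<le> k 0" by simp
  moreover have "?c 1 = b" "?c 0 = a" by (auto simp: d_def)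
  ultimately show ?thesis
    unfolding k_def d_def[symmetric] by (simp add: mult_ac)
qed

section \<open>Tikhonov regularisation under an approximate source condition\<close>

text \<open>The numbers stand for \<open>q = \<parallel>F a - h\<delta>\<parallel>\<close>, \<open>x = \<parallel>a - adag\<parallel>\<close>, \<open>W = \<parallel>w\<parallel>\<close>,
\<open>E = \<parallel>e\<parallel>\<close> and \<open>\<kappa> = L W\<close>. Young's inequality removes \<open>q\<close> at the expense of
\<open>\<alpha>\<^sup>2 W\<^sup>2\<close>. The quadratic term on the right is absorbed because \<open>\<kappa> < 1\<close>, and a second use of
Young's inequality, weighted by \<open>1 - \<kappa>\<close>, removes the term linear in \<open>x\<close>.\<close>

lemma source_condition_absorption:
  fixes q x W E \<kappa> \<delta> \<alpha> :: real
  assumes key: "q\<^sup>2 + \<alpha> * x\<^sup>2 \<le> \<delta>\<^sup>2 + 2 * \<alpha> * (W * (\<delta> + q) + \<kappa> / 2 * x\<^sup>2 + E * x)"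
    and \<kappa>: "\<kappa> < 1" and \<alpha>: "\<alpha> > 0" and \<delta>: "\<delta> \<ge> 0" and W: "W \<ge> 0"
  shows "x\<^sup>2 \<le> (4 / (1 - \<kappa>) + 4 / (1 - \<kappa>)\<^sup>2) * (\<delta>\<^sup>2 / \<alpha> + \<alpha> * W\<^sup>2 + \<delta> * W + E\<^sup>2)"
proof -
  define \<theta> where "\<theta> = 1 - \<kappa>"
  have \<theta>: "\<theta> > 0" using \<kappa> by (simp add: \<theta>_def)
  define U where "U = \<delta>\<^sup>2 / \<alpha> + \<alpha> * W\<^sup>2 + \<delta> * W"
  have U: "U \<ge> 0" "\<delta> * W \<le> U" unfolding U_def using \<alpha> \<delta> W by simp_all
  have "0 \<le> (q - \<alpha> * W)\<^sup>2" by simp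
  then have "\<alpha> * (\<theta> * x\<^sup>2) \<le> \<delta>\<^sup>2 + (\<alpha> * W)\<^sup>2 + 2 * \<alpha> * (\<delta> * W) + 2 * \<alpha> * (E * x)"
    using key by (simp add: \<theta>_def power2_diff algebra_simps)
  also have "\<dots> = \<alpha> * (U + \<delta> * W + 2 * (E * x))"
    using \<alpha> by (simp add: U_def field_simps power2_eq_square)
  finally have 1: "\<theta> * x\<^sup>2 \<le> U + \<delta> * W + 2 * (E * x)"
    using \<alpha> by simp
  have "0 \<le> (\<theta> * x - 2 * E)\<^sup>2" by simp
  then have 2: "\<theta> * (4 * (E * x)) \<le> \<theta> * (\<theta> * x\<^sup>2) + 4 * E\<^sup>2"
    by (simp add: power2_eq_square algebra_simps)
  have "\<theta> * (2 * (\<theta> * x\<^sup>2)) \<le> \<theta> * (4 * U + 4 * (E * x))"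
    using 1 U \<theta> by (intro mult_left_mono) auto
  with 2 have 3: "\<theta>\<^sup>2 * x\<^sup>2 \<le> 4 * (\<theta> * U) + 4 * E\<^sup>2"
    by (simp add: power2_eq_square algebra_simps)
  also have "\<dots> \<le> (4 * \<theta> + 4) * (U + E\<^sup>2)"
    using U \<theta> by (simp add: algebra_simps)
  finally have "x\<^sup>2 \<le> (4 * \<theta> + 4) * (U + E\<^sup>2) / \<theta>\<^sup>2"
    using \<theta> by (simp add: pos_le_divide_eq mult.commute)
  also have "\<dots> = (4 / \<theta> + 4 / \<theta>\<^sup>2) * (U + E\<^sup>2)"
    using \<theta> by (simp add: field_simps power2_eq_square)
  finally show ?thesis
    by (simp add: \<theta>_def U_def)
qed

text \<open>The rate for an arbitrary operator with Lipschitz continuous derivative on a convex set of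
parameters. The remainder estimate enters with the sign of \<open>- \<langle>F'(adag) d, w\<rangle>\<close>, so a one-sided
bound suffices.\<close>

lemma tikhonov_source_condition_estimate:
  assumes fr: "frechet_rel lo hi T D F F'" and w: "w \<in> L2 {0<..<T}"
    and conv: "\<And>a b s. a \<in> D \<Longrightarrow> b \<in> D \<Longrightarrow> 0 \<le> s \<Longrightarrow> s \<le> 1 \<Longrightarrow> (\<lambda>y. a y + s * (b y - a y)) \<in> D"
    and D: "D \<subseteq> sobolev 2 lo hi"
    and lip: "\<And>a b. a \<in> D \<Longrightarrow> b \<in> D \<Longrightarrow> opnorm_H2_L2 lo hi T (\<lambda>h t. F' a h t - F' b h t)
          \<le> L * sobolev_norm 2 {lo<..<hi} (\<lambda>y. a y - b y)"
    and adag: "adag \<in> D" and astar: "astar \<in> sobolev 2 lo hi"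
    and adj: "is_hilbert_adjoint lo hi T (F' adag) F'adj"
    and e: "e \<in> sobolev 2 lo hi"
    and source: "\<And>y. y \<in> {lo..hi} \<Longrightarrow> adag y - astar y = F'adj w y + e y"
    and small: "L * l2_norm {0<..<T} w < 1"
    and \<delta>: "\<delta> \<ge> 0" and hdelta: "hdelta \<in> L2 {0<..<T}"
    and noise: "l2_norm {0<..<T} (\<lambda>t. hdelta t - F adag t) \<le> \<delta>"
    and \<alpha>: "\<alpha> > 0" and a: "a \<in> D"
    and minimal: "tikhonov lo hi T F \<alpha> hdelta astar a \<le> tikhonov lo hi T F \<alpha> hdelta astar adag"
  shows "(sobolev_norm 2 {lo<..<hi} (\<lambda>y. adag y - a y))\<^sup>2
    \<le> (4 / (1 - L * l2_norm {0<..<T} w) + 4 / (1 - L * l2_norm {0<..<T} w)\<^sup>2)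
       * (\<delta>\<^sup>2 / \<alpha> + \<alpha> * (l2_norm {0<..<T} w)\<^sup>2 + \<delta> * l2_norm {0<..<T} w
          + (sobolev_norm 2 {lo<..<hi} e)\<^sup>2)"
proof -
  let ?I = "l2_inner {0<..<T}" and ?N = "l2_norm {0<..<T}"
  let ?J = "sobolev_inner 2 {lo<..<hi}" and ?H = "sobolev_norm 2 {lo<..<hi}"
  define d where "d = (\<lambda>y. a y - adag y)"
  define z where "z = (\<lambda>y. adag y - astar y)"
  define q where "q = ?N (\<lambda>t. F a t - hdelta t)"
  have mem: "adag \<in> sobolev 2 lo hi" "a \<in> sobolev 2 lo hi"
    using adag a D by auto
  have d: "d \<in> sobolev 2 lo hi" and z: "z \<in> sobolev 2 lo hi"
    unfolding d_def z_def using mem astar by (simp_all add: sobolev.diff_mem)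
  have F: "F a \<in> L2 {0<..<T}" "F adag \<in> L2 {0<..<T}"
    using fr a adag unfolding frechet_rel_def by blast+
  have Fw: "F'adj w \<in> sobolev 2 lo hi" "?I (F' adag d) w = ?J d (F'adj w)"
    using adj w d unfolding is_hilbert_adjoint_def by blast+
  have dist: "?H (\<lambda>y. adag y - a y) = ?H d"
    unfolding d_def by (rule sobolev.seminorm_minus_commute[OF mem])
  have noise': "?N (\<lambda>t. F adag t - hdelta t) \<le> \<delta>"
    using noise L2.seminorm_minus_commute[OF hdelta F(2)] by simp
  have "(\<lambda>y. a y - astar y) = (\<lambda>y. z y + d y)"
    by (auto simp: z_def d_def)
  then have "(?H (\<lambda>y. a y - astar y))\<^sup>2 = (?H z)\<^sup>2 + 2 * ?J z d + (?H d)\<^sup>2"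
    using sobolev.seminorm_add_square[OF z d] by (simp add: sobolev.seminorm_square z d)
  with minimal have "q\<^sup>2 + \<alpha> * ((?H z)\<^sup>2 + 2 * ?J z d + (?H d)\<^sup>2)
      \<le> (?N (\<lambda>t. F adag t - hdelta t))\<^sup>2 + \<alpha> * (?H z)\<^sup>2"
    by (simp add: tikhonov_def q_def z_def)
  moreover have "(?N (\<lambda>t. F adag t - hdelta t))\<^sup>2 \<le> \<delta>\<^sup>2"
    by (intro power_mono noise' L2.seminorm_nonneg L2.diff_mem F hdelta)
  ultimately have min: "q\<^sup>2 + \<alpha> * (?H d)\<^sup>2 \<le> \<delta>\<^sup>2 + 2 * \<alpha> * (- ?J z d)"
    by (simp add: algebra_simps)
  \<comment> \<open>the source condition holds on the interval only, which is all that the inner product sees\<close>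
  have "?J z d = ?J (\<lambda>y. F'adj w y + e y) d"
    by (rule sobolev_inner_cong) (simp add: z_def source)
  also have "\<dots> = ?I (F' adag d) w + ?J e d"
    by (simp add: sobolev.ip_add Fw e d sobolev.ip_commute[OF Fw(1) d])
  finally have Jz: "?J z d = ?I (F' adag d) w + ?J e d" .
  have e_part: "- ?J e d \<le> ?H e * ?H d"
    using sobolev.Cauchy_Schwarz[OF e d] by simp
  have lin_part: "- ?I (F' adag d) w \<le> ?N w * (\<delta> + q) + L * ?N w / 2 * (?H d)\<^sup>2"
  proof -
    have "- ?I (F' adag d) w \<le> ?I (F adag) w - ?I (F a) w + L / 2 * ?N w * (?H d)\<^sup>2"
      using taylor_remainder[OF fr w conv D lip adag a] unfolding d_def by linarith
    moreover have "?I (F adag) w - ?I hdelta w \<le> \<delta> * ?N w"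
      using L2.ip_le[OF L2.diff_mem[OF F(2) hdelta] w] L2.ip_diff[OF F(2) hdelta w]
        mult_right_mono[OF noise' L2.seminorm_nonneg[OF w]] by simp
    moreover have "?I hdelta w - ?I (F a) w \<le> q * ?N w"
      using L2.Cauchy_Schwarz[OF L2.diff_mem[OF F(1) hdelta] w] L2.ip_diff[OF F(1) hdelta w]
      by (simp add: q_def)
    ultimately show ?thesis by (simp add: algebra_simps)
  qed
  have "q\<^sup>2 + \<alpha> * (?H d)\<^sup>2
      \<le> \<delta>\<^sup>2 + 2 * \<alpha> * (?N w * (\<delta> + q) + L * ?N w / 2 * (?H d)\<^sup>2 + ?H e * ?H d)"
  proof -
    have "- ?J z d \<le> ?N w * (\<delta> + q) + L * ?N w / 2 * (?H d)\<^sup>2 + ?H e * ?H d"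
      using Jz e_part lin_part by linarith
    then have "2 * \<alpha> * (- ?J z d)
        \<le> 2 * \<alpha> * (?N w * (\<delta> + q) + L * ?N w / 2 * (?H d)\<^sup>2 + ?H e * ?H d)"
      using \<alpha> by (intro mult_left_mono) auto
    with min show ?thesis by linarith
  qed
  from source_condition_absorption[OF this small \<alpha> \<delta> L2.seminorm_nonneg[OF w]]
  show ?thesis unfolding dist .
qed

text \<open>The abstract estimate applies since admissible parameters form a convex set; the constant is a
function of \<open>L \<parallel>w\<parallel>\<close> alone.\<close>

theorem theorem5p5:
  shows "\<exists>C :: real \<Rightarrow> real.
    \<forall>a0 a1 a2 a3 T c g0 g1 lo hi F F' D L adag h astar F'adj w e \<delta> h\<delta> \<alpha> a\<alpha>\<delta>.
      standing_assumptions a0 a1 a2 a3 T c g0 g1 lo hi \<longrightarrow>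
      D = admissible a0 a1 a2 a3 lo hi \<longrightarrow>
      F = forward a0 a1 a2 a3 T c g0 g1 lo hi \<longrightarrow>
      F' = forward_deriv a0 a1 a2 a3 T c g0 g1 lo hi \<longrightarrow>
      frechet_rel lo hi T D F F' \<longrightarrow>
      (\<forall>a\<in>D. \<forall>a'\<in>D. opnorm_H2_L2 lo hi T (\<lambda>b t. F' a b t - F' a' b t)
          \<le> L * sobolev_norm 2 {lo<..<hi} (\<lambda>y. a y - a' y)) \<longrightarrow>
      adag \<in> D \<longrightarrow>
      h = F adag \<longrightarrow>
      astar \<in> sobolev 2 lo hi \<longrightarrow>
      is_hilbert_adjoint lo hi T (F' adag) F'adj \<longrightarrow>
      w \<in> L2 {0<..<T} \<longrightarrow>
      e \<in> sobolev 2 lo hi \<longrightarrow>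
      (\<forall>y\<in>{lo..hi}. adag y - astar y = F'adj w y + e y) \<longrightarrow>
      L * l2_norm {0<..<T} w < 1 \<longrightarrow>
      \<delta> \<ge> 0 \<longrightarrow>
      h\<delta> \<in> L2 {0<..<T} \<longrightarrow>
      l2_norm {0<..<T} (\<lambda>t. h\<delta> t - h t) \<le> \<delta> \<longrightarrow>
      \<alpha> > 0 \<longrightarrow>
      a\<alpha>\<delta> \<in> D \<longrightarrow>
      (\<forall>a\<in>D. tikhonov lo hi T F \<alpha> h\<delta> astar a\<alpha>\<delta> \<le> tikhonov lo hi T F \<alpha> h\<delta> astar a) \<longrightarrow>
      (sobolev_norm 2 {lo<..<hi} (\<lambda>y. adag y - a\<alpha>\<delta> y))\<^sup>2
        \<le> C (L * l2_norm {0<..<T} w)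
           * (\<delta>\<^sup>2 / \<alpha> + \<alpha> * (l2_norm {0<..<T} w)\<^sup>2 + \<delta> * l2_norm {0<..<T} w
              + (sobolev_norm 2 {lo<..<hi} e)\<^sup>2)"
proof (intro exI[of _ "\<lambda>\<kappa>. 4 / (1 - \<kappa>) + 4 / (1 - \<kappa>)\<^sup>2"] allI impI, goal_cases)
  case (1 a0 a1 a2 a3 T c g0 g1 lo hi F F' D L adag h astar F'adj w e \<delta> h\<delta> \<alpha> a\<alpha>\<delta>)
  note D = \<open>D = admissible a0 a1 a2 a3 lo hi\<close>
  show ?case
  proof (rule tikhonov_source_condition_estimate[where F = F and F' = F' and D = D and astar = astar
        and F'adj = F'adj and hdelta = h\<delta>])
    show "(\<lambda>y. a y + s * (b y - a y)) \<in> D" if "a \<in> D" "b \<in> D" "0 \<le> s" "s \<le> 1" for a b s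
      using that unfolding D by (rule admissible_convex)
    show "D \<subseteq> sobolev 2 lo hi"
      unfolding D admissible_def by blast
  qed (use 1 in blast)+
qed

end
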